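(* Let $S$ be a Polish space with Borel $\sigma$-field $\mathcal S$, let $\partial\notin S$, $S^*=S\cup\{\partial\}$, and let $\mathcal E=(E_j)_{j\ge0}$ be a fixed countable measurable partition of $S^*$ with $E_0=\{\partial\}$. Let $(Y_n)_{n\ge0}$ be a hidden Markov model on $S$ with recurrent underlying Markov chain. Then, for each $j\ge1$, the row $(V_{j,n})_{n\ge1}$ of the successors array of $(Y_n)$ is a hidden Markov model (with values in $S^*$) with recurrent underlying Markov chain.
   Context: Successors array: for $j,n\ge1$, $V_{j,n}$ is the value of $Y$ immediately following the $n$-th visit of $Y$ to $E_j$ (that is, $V_{j,n}=Y_{\tau+1}$ where $\tau$ is the $n$-th time $t\ge0$ with $Y_t\in E_j$). If $Y$ visits $E_j$ only $m<\infty$ times, $V_{j,n}=\partial$ for all $n>m$. Hidden Markov model (HMM): a sequence $(Z_n)_{n\ge n_0}$ with values in a Polish space $R$ with Borel $\sigma$-field $\mathcal R$ ($n_0=0$ and $R=S$ for $Y$; $n_0=1$ and $R=S^*$ for the rows $V_{j,\cdot}$) is an HMM if there is a pair of processes $(X_n,\widetilde Z_n)_{n\ge n_0}$ with values in $\mathcal X\times R$, $\mathcal X$ a discrete (countable) space, such that (1) $(X_n)$ is a time homogeneous Markov chain on $\mathcal X$ (the underlying Markov chain); (2) for all $N\ge n_0$ and $S_{n_0},\dots,S_N\in\mathcal R$, $\mathbb P(\widetilde Z_{n_0}\in S_{n_0},\dots,\widetilde Z_N\in S_N\mid X_{n_0}^N=x_{n_0}^N)=\prod_{n=n_0}^N\mathbb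 P(\widetilde Z_n\in S_n\mid X_n=x_n)$, where the read-out distributions $f_x(\bar S)=\mathbb P(\widetilde Z_n\in\bar S\mid X_n=x)$ do not depend on $n$; (3) $(Z_n)$ and $(\widetilde Z_n)$ have the same finite-dimensional distributions. Recurrence: a time homogeneous Markov chain $(X_n)_{n\ge n_0}$ is recurrent if $\mathbb P(X_n=x\text{ for infinitely many }n\mid X_{n_0}=x)=1$ for all $x\in\mathcal X$ with $\mathbb P(X_{n_0}=x)>0$; such chains visit no transient states, but may have more than one recurrence class. *)

theory Defs
  imports "HOL-Probability.Probability"
begin

text \<open>For a Polish space \<open>S\<close>, given by a type of class \<^class>\<open>polish_space\<close>, the space
  \<open>S\<^sup>* = S \<union> {\<partial>}\<close> is the option type over \<open>S\<close>: \<^term>\<open>None\<close> is \<open>\<partial>\<close>, an isolated point, and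
  \<^term>\<open>Some\<close> is the inclusion of \<open>S\<close>. The metric is capped at 1 so that adjoining \<open>\<partial>\<close> at distance 1
  keeps the triangle inequality; the topology and the Borel sets are characterised by
  \<open>open_option_iff\<close> and \<open>sets_borel_option_iff\<close> below.\<close>

instantiation option :: (metric_space) metric_space
begin

definition dist_option :: "'a option \<Rightarrow> 'a option \<Rightarrow> real" where
  "dist_option x y =
     (case x of
        None \<Rightarrow> (case y of None \<Rightarrow> 0 | Some b \<Rightarrow> 1)
      | Some a \<Rightarrow> (case y of None \<Rightarrow> 1 | Some b \<Rightarrow> min 1 (dist a b)))"

definition uniformity_option :: "('a option \<times> 'a option) filter" where
  "uniformity_option = (INF e\<in>{0<..}. principal {(x, y). dist x y < e})"

definition open_option :: "'a option set \<Rightarrow> bool" where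
  "open_option U \<longleftrightarrow> (\<forall>x\<in>U. eventually (\<lambda>(x', y). x' = x \<longrightarrow> y \<in> U) uniformity)"

instance
proof
  show "(uniformity :: ('a option \<times> 'a option) filter) =
      (INF e\<in>{0<..}. principal {(x, y). dist x y < e})"
    by (rule uniformity_option_def)
  show "open U \<longleftrightarrow> (\<forall>x\<in>U. eventually (\<lambda>(x', y). x' = x \<longrightarrow> y \<in> U) uniformity)"
    for U :: "'a option set"
    by (rule open_option_def)
  show "dist x y = 0 \<longleftrightarrow> x = y" for x y :: "'a option"
    by (auto simp: dist_option_def min_def split: option.splits)
  show "dist x y \<le> dist x z + dist y z" for x y z :: "'a option"
  proof -
    have "min 1 (dist a b) \<le> min 1 (dist a c) + min 1 (dist b c)" for a b c :: 'a
      using dist_triangle2[of a b c] zero_le_dist[of a c] zero_le_dist[of b c]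
      by (smt (verit) min_def)
    then show ?thesis
      by (auto simp: dist_option_def split: option.splits)
  qed
qed

end

lemma dist_option_simps [simp]:
  "dist None None = (0::real)" "dist None (Some b) = 1" "dist (Some a) None = 1"
  "dist (Some a) (Some b) = min 1 (dist a b)"
  by (simp_all add: dist_option_def)

lemma open_option_iff:
  fixes U :: "'a::metric_space option set"
  shows "open U \<longleftrightarrow> open (Some -` U)"
proof
  assume U: "open U"
  show "open (Some -` U)"
    unfolding open_dist
  proof
    fix x assume "x \<in> Some -` U"
    then obtain e where e: "e > 0" "\<And>y. dist y (Some x) < e \<Longrightarrow> y \<in> U"
      using U unfolding open_dist by auto
    have "Some y \<in> U" if "dist y x < e" for y
      using that by (intro e(2)) auto
    then show "\<exists>e>0. \<forall>y. dist y x < e \<longrightarrow> y \<in> Some -` U"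
      using e(1) by auto
  qed
next
  assume U: "open (Some -` U)"
  show "open U"
    unfolding open_dist
  proof
    fix x assume x: "x \<in> U"
    show "\<exists>e>0. \<forall>y. dist y x < e \<longrightarrow> y \<in> U"
    proof (cases x)
      case None
      have "y \<in> U" if "dist y x < 1" for y
        using that x None by (cases y) auto
      then show ?thesis by (intro exI[of _ 1]) auto
    next
      case (Some a)
      with x U obtain e where e: "e > 0" "\<And>y. dist y a < e \<Longrightarrow> Some y \<in> U"
        unfolding open_dist by auto
      have "y \<in> U" if "dist y x < min 1 e" for y
        using that Some e(2) by (cases y) (auto simp: min_def split: if_splits)
      then show ?thesis
        using e(1) by (intro exI[of _ "min 1 e"]) auto
    qed
  qed
qed

instance option :: (complete_space) complete_space
proof
  fix X :: "nat \<Rightarrow> 'a option" assume X: "Cauchy X"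
  then obtain N where N: "\<And>m n. m \<ge> N \<Longrightarrow> n \<ge> N \<Longrightarrow> dist (X m) (X n) < 1"
    unfolding Cauchy_def by (meson zero_less_one)
  show "convergent X"
  proof (cases "X N")
    case None
    have "X n = None" if "n \<ge> N" for n
      using N[OF le_refl that] None by (cases "X n") auto
    then have "\<forall>\<^sub>F n in sequentially. X n = None"
      by (auto simp: eventually_sequentially)
    then show ?thesis
      unfolding convergent_def by (blast intro: tendsto_eventually)
  next
    case (Some a)
    define Y where "Y n = the (X (n + N))" for n
    have XY: "X (n + N) = Some (Y n)" for n
      using N[of N "n + N"] Some unfolding Y_def by (cases "X (n + N)") auto
    have "Cauchy Y"
      unfolding Cauchy_def
    proof (intro allI impI)
      fix e :: real assume "e > 0"
      then have "min 1 e > 0" by simp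
      then obtain K where K: "\<And>m n. m \<ge> K \<Longrightarrow> n \<ge> K \<Longrightarrow> dist (X m) (X n) < min 1 e"
        using X unfolding Cauchy_def by meson
      have "dist (Y m) (Y n) < e" if "m \<ge> K" "n \<ge> K" for m n
        using K[of "m + N" "n + N"] that by (auto simp: XY min_def split: if_splits)
      then show "\<exists>M. \<forall>m\<ge>M. \<forall>n\<ge>M. dist (Y m) (Y n) < e" by blast
    qed
    then obtain L where L: "Y \<longlonglongrightarrow> L"
      using Cauchy_convergent convergent_def by blast
    have "(\<lambda>n. X (n + N)) \<longlonglongrightarrow> Some L"
    proof (rule tendstoI)
      fix e :: real assume "e > 0"
      then have "\<forall>\<^sub>F n in sequentially. dist (Y n) L < e"
        using L by (rule tendstoD[rotated])
      then show "\<forall>\<^sub>F n in sequentially. dist (X (n + N)) (Some L) < e"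
        by eventually_elim (simp add: XY)
    qed
    then show ?thesis
      unfolding convergent_def using LIMSEQ_offset by blast
  qed
qed

instance option :: (polish_space) polish_space
proof
  obtain B :: "'a set set" where B: "countable B" "topological_basis B"
    using ex_countable_basis by blast
  define C where "C = insert {None} ((`) Some ` B)"
  have "topological_basis C"
  proof (rule topological_basisI)
    fix U assume "U \<in> C"
    moreover have "Some -` {None} = ({} :: 'a set)" "Some -` (Some ` b) = b" for b :: "'a set"
      by auto
    ultimately show "open U"
      using topological_basis_open[OF B(2)] unfolding C_def open_option_iff by fastforce
  next
    fix U and x :: "'a option" assume U: "open U" "x \<in> U"
    show "\<exists>V\<in>C. x \<in> V \<and> V \<subseteq> U"
    proof (cases x)
      case None
      with U show ?thesis by (auto simp: C_def)
    next
      case (Some a)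
      with U obtain V where "V \<in> B" "a \<in> V" "V \<subseteq> Some -` U"
        using topological_basisE[OF B(2), of "Some -` U" a] by (auto simp: open_option_iff)
      with Some show ?thesis
        by (intro bexI[of _ "Some ` V"]) (auto simp: C_def)
    qed
  qed
  moreover have "countable C"
    using B(1) by (simp add: C_def)
  ultimately show "\<exists>B::'a option set set. countable B \<and> open = generate_topology B"
    using topological_basis_imp_subbasis by blast
qed

lemma sets_borel_option_iff:
  fixes A :: "'a::metric_space option set"
  shows "A \<in> sets borel \<longleftrightarrow> Some -` A \<in> sets borel"
proof
  assume "A \<in> sets borel"
  moreover have "(Some :: 'a \<Rightarrow> _) \<in> borel_measurable borel"
    by (rule borel_measurableI) (simp add: open_option_iff)
  ultimately show "Some -` A \<in> sets borel"
    using measurable_sets[of Some borel borel A] by simp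
next
  assume A: "Some -` A \<in> sets borel"
  define g :: "'a option \<Rightarrow> 'a" where "g x = (case x of None \<Rightarrow> undefined | Some a \<Rightarrow> a)" for x
  have "g \<in> borel_measurable borel"
    by (rule borel_measurableI) (simp add: open_option_iff g_def vimage_def)
  from measurable_sets[OF this A] have 1: "g -` (Some -` A) \<in> sets borel"
    by simp
  have N: "{None :: 'a option} \<in> sets borel"
    by (rule borel_open) (simp add: open_option_iff vimage_def)
  have "A = (g -` (Some -` A) - {None}) \<union> (if None \<in> A then {None} else {})"
    by (auto simp: g_def split: option.splits if_splits)
  also have "\<dots> \<in> sets borel"
    using 1 N by auto
  finally show "A \<in> sets borel" .
qed

text \<open>Processes are families indexed by \<^typ>\<open>nat\<close> of which only the members with index
  \<open>n \<ge> n\<^sub>0\<close> matter. Conditional probabilities given an event are only used when that event has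
  positive probability.\<close>

definition markov_chain ::
    "'w measure \<Rightarrow> nat \<Rightarrow> 'x set \<Rightarrow> (nat \<Rightarrow> 'w \<Rightarrow> 'x) \<Rightarrow> bool" where
  "markov_chain P n\<^sub>0 \<X> X \<longleftrightarrow>
     countable \<X> \<and>
     (\<forall>n\<ge>n\<^sub>0. X n \<in> measurable P (count_space \<X>)) \<and>
     (\<exists>K :: 'x \<Rightarrow> 'x pmf.
        (\<forall>x\<in>\<X>. set_pmf (K x) \<subseteq> \<X>) \<and>
        (\<forall>N\<ge>n\<^sub>0. \<forall>x :: nat \<Rightarrow> 'x. \<forall>y\<in>\<X>.
           \<P>(\<omega> in P. \<forall>n\<in>{n\<^sub>0..N}. X n \<omega> = x n) > 0 \<longrightarrow>
           \<P>(\<omega> in P. X (Suc N) \<omega> = y \<bar> \<forall>n\<in>{n\<^sub>0..N}. X n \<omega> = x n) = pmf (K (x N)) y))"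

definition recurrent_chain ::
    "'w measure \<Rightarrow> nat \<Rightarrow> 'x set \<Rightarrow> (nat \<Rightarrow> 'w \<Rightarrow> 'x) \<Rightarrow> bool" where
  "recurrent_chain P n\<^sub>0 \<X> X \<longleftrightarrow>
     (\<forall>x\<in>\<X>. \<P>(\<omega> in P. X n\<^sub>0 \<omega> = x) > 0 \<longrightarrow>
        \<P>(\<omega> in P. infinite {n. n \<ge> n\<^sub>0 \<and> X n \<omega> = x} \<bar> X n\<^sub>0 \<omega> = x) = 1)"

definition same_fdd ::
    "nat \<Rightarrow> 'w measure \<Rightarrow> (nat \<Rightarrow> 'w \<Rightarrow> 'r::topological_space) \<Rightarrow>
     'v measure \<Rightarrow> (nat \<Rightarrow> 'v \<Rightarrow> 'r) \<Rightarrow> bool" where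
  "same_fdd n\<^sub>0 M Z P W \<longleftrightarrow>
     (\<forall>J. finite J \<and> J \<subseteq> {n\<^sub>0..} \<longrightarrow>
        distr M (\<Pi>\<^sub>M n\<in>J. borel) (\<lambda>\<omega>. \<lambda>n\<in>J. Z n \<omega>) =
        distr P (\<Pi>\<^sub>M n\<in>J. borel) (\<lambda>\<omega>. \<lambda>n\<in>J. W n \<omega>))"

definition hmm_pair ::
    "'w measure \<Rightarrow> nat \<Rightarrow> 'x set \<Rightarrow> (nat \<Rightarrow> 'w \<Rightarrow> 'x) \<Rightarrow>
     (nat \<Rightarrow> 'w \<Rightarrow> 'r::polish_space) \<Rightarrow> bool" where
  "hmm_pair P n\<^sub>0 \<X> X W \<longleftrightarrow>
     prob_space P \<and>
     markov_chain P n\<^sub>0 \<X> X \<and>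
     (\<forall>n\<ge>n\<^sub>0. W n \<in> borel_measurable P) \<and>
     (\<forall>N\<ge>n\<^sub>0. \<forall>A :: nat \<Rightarrow> 'r set. \<forall>x :: nat \<Rightarrow> 'x.
        (\<forall>n. A n \<in> sets borel) \<longrightarrow>
        \<P>(\<omega> in P. \<forall>n\<in>{n\<^sub>0..N}. X n \<omega> = x n) > 0 \<longrightarrow>
        \<P>(\<omega> in P. \<forall>n\<in>{n\<^sub>0..N}. W n \<omega> \<in> A n \<bar> \<forall>n\<in>{n\<^sub>0..N}. X n \<omega> = x n) =
          (\<Prod>n\<in>{n\<^sub>0..N}. \<P>(\<omega> in P. W n \<omega> \<in> A n \<bar> X n \<omega> = x n))) \<and>
     (\<exists>f :: 'x \<Rightarrow> 'r measure.
        (\<forall>x\<in>\<X>. prob_space (f x) \<and> sets (f x) = sets borel) \<and>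
        (\<forall>n\<ge>n\<^sub>0. \<forall>x\<in>\<X>. \<forall>A\<in>sets borel.
           \<P>(\<omega> in P. X n \<omega> = x) > 0 \<longrightarrow>
           \<P>(\<omega> in P. W n \<omega> \<in> A \<bar> X n \<omega> = x) = measure (f x) A))"

text \<open>HOL cannot quantify existentially over the type of the auxiliary probability space and of the
  state space, so they are existentially quantified over the types of the path space of pairs
  and of \<^typ>\<open>nat\<close>. This is no restriction: lemma \<open>recurrent_hmmI\<close> below shows that a pair of
  processes on any probability space with any countable state space is a valid witness.\<close>

definition recurrent_hmm ::
    "'w measure \<Rightarrow> nat \<Rightarrow> (nat \<Rightarrow> 'w \<Rightarrow> 'r::polish_space) \<Rightarrow> bool" where
  "recurrent_hmm M n\<^sub>0 Z \<longleftrightarrow>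
     (\<forall>n\<ge>n\<^sub>0. Z n \<in> borel_measurable M) \<and>
     (\<exists>(P :: (nat \<Rightarrow> nat \<times> 'r) measure) (\<X> :: nat set) X W.
        hmm_pair P n\<^sub>0 \<X> X W \<and> recurrent_chain P n\<^sub>0 \<X> X \<and> same_fdd n\<^sub>0 M Z P W)"

lemma recurrent_hmmI:
  fixes P :: "'v measure" and \<X> :: "'x set"
    and Z :: "nat \<Rightarrow> 'w \<Rightarrow> 'r::polish_space" and W :: "nat \<Rightarrow> 'v \<Rightarrow> 'r"
  assumes Z: "\<And>n. n \<ge> n\<^sub>0 \<Longrightarrow> Z n \<in> borel_measurable M"
    and pair: "hmm_pair P n\<^sub>0 \<X> X W"
    and recur: "recurrent_chain P n\<^sub>0 \<X> X"
    and fdd: "same_fdd n\<^sub>0 M Z P W"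
  shows "recurrent_hmm M n\<^sub>0 Z"
proof -
  have P: "prob_space P" and chain: "markov_chain P n\<^sub>0 \<X> X"
    and W [measurable]: "\<And>n. n \<ge> n\<^sub>0 \<Longrightarrow> W n \<in> borel_measurable P"
    using pair by (auto simp: hmm_pair_def)
  interpret prob_space P by (rule P)
  have cX: "countable \<X>" and X: "\<And>n. n \<ge> n\<^sub>0 \<Longrightarrow> X n \<in> measurable P (count_space \<X>)"
    using chain by (auto simp: markov_chain_def)
  have XX: "X n \<omega> \<in> \<X>" if "n \<ge> n\<^sub>0" "\<omega> \<in> space P" for n \<omega>
    using measurable_space[OF X[OF that(1)] that(2)] by simp
  obtain x0 where x0: "x0 \<in> \<X>"
    using XX[of n\<^sub>0] not_empty by blast
  define g where "g = to_nat_on \<X>"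
  define h where "h = from_nat_into \<X>"
  have hg [simp]: "h (g x) = x" if "x \<in> \<X>" for x
    using that cX by (simp add: g_def h_def)
  have h_in: "h k \<in> \<X>" for k
    using x0 by (auto simp: h_def intro!: from_nat_into)
  define \<X>' where "\<X>' = g ` \<X>"
  have gh: "g (h k) = k" if "k \<in> \<X>'" for k
    using that by (auto simp: \<X>'_def)
  have geq: "g x = k \<longleftrightarrow> x = h k" if "k \<in> \<X>'" "x \<in> \<X>" for x k
    using that gh by auto
  have g_inj: "g x = g y \<longleftrightarrow> x = y" if "x \<in> \<X>" "y \<in> \<X>" for x y
    using that hg by metis

  define Q :: "(nat \<Rightarrow> nat \<times> 'r) measure"
    where "Q = (\<Pi>\<^sub>M n\<in>UNIV. count_space UNIV \<Otimes>\<^sub>M borel)"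
  define \<Phi> where "\<Phi> \<omega> n = (if n\<^sub>0 \<le> n then (g (X n \<omega>), W n \<omega>) else (0, undefined))" for \<omega> n
  define X' where "X' n s = (if fst (s n) \<in> \<X>' then fst (s n) else g x0)"
    for n and s :: "nat \<Rightarrow> nat \<times> 'r"
  define W' where "W' n s = snd (s n)" for n and s :: "nat \<Rightarrow> nat \<times> 'r"
  define P' where "P' = distr P Q \<Phi>"

  have \<Phi> [measurable]: "\<Phi> \<in> measurable P Q"
    unfolding Q_def
  proof (rule measurable_PiM_single')
    fix n :: nat
    show "(\<lambda>\<omega>. \<Phi> \<omega> n) \<in> P \<rightarrow>\<^sub>M count_space UNIV \<Otimes>\<^sub>M borel"
    proof (cases "n\<^sub>0 \<le> n")
      case True
      have "(\<lambda>\<omega>. g (X n \<omega>)) \<in> measurable P (count_space UNIV)"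
        by (rule measurable_compose[OF X[OF True]]) simp
      with W[OF True] True show ?thesis
        by (simp add: \<Phi>_def)
    qed (simp add: \<Phi>_def)
  qed (auto simp: space_pair_measure)
  have comp [measurable]: "(\<lambda>s. s n) \<in> measurable Q (count_space UNIV \<Otimes>\<^sub>M borel)" for n
    unfolding Q_def by simp
  have fstm [measurable]: "(\<lambda>s. fst (s n)) \<in> measurable Q (count_space UNIV)" for n
    by measurable
  have X'm [measurable]: "X' n \<in> measurable Q (count_space UNIV)" for n
    unfolding X'_def by measurable
  have W'm [measurable]: "W' n \<in> borel_measurable Q" for n
    unfolding W'_def by measurable
  have X'\<Phi>: "X' n (\<Phi> \<omega>) = g (X n \<omega>)" and W'\<Phi>: "W' n (\<Phi> \<omega>) = W n \<omega>"
    if "n \<ge> n\<^sub>0" "\<omega> \<in> space P" for n \<omega>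
    using that XX by (auto simp: X'_def W'_def \<Phi>_def \<X>'_def)
  have X'_in: "X' n s \<in> \<X>'" for n s
    using x0 by (auto simp: X'_def \<X>'_def)

  have prob': "\<P>(s in P'. R s) = \<P>(\<omega> in P. R' \<omega>)"
    if [measurable]: "Measurable.pred Q R" and R: "\<And>\<omega>. \<omega> \<in> space P \<Longrightarrow> R (\<Phi> \<omega>) = R' \<omega>" for R R'
  proof -
    have "\<P>(s in P'. R s) = measure P (\<Phi> -` {s \<in> space Q. R s} \<inter> space P)"
      unfolding P'_def space_distr by (rule measure_distr) measurable
    also have "\<Phi> -` {s \<in> space Q. R s} \<inter> space P = {\<omega> \<in> space P. R' \<omega>}"
      using R measurable_space[OF \<Phi>] by auto
    finally show ?thesis .
  qed
  have cprob': "\<P>(s in P'. R s \<bar> S s) = \<P>(\<omega> in P. R' \<omega> \<bar> S' \<omega>)"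
    if [measurable]: "Measurable.pred Q R" "Measurable.pred Q S"
      and "\<And>\<omega>. \<omega> \<in> space P \<Longrightarrow> R (\<Phi> \<omega>) = R' \<omega>" "\<And>\<omega>. \<omega> \<in> space P \<Longrightarrow> S (\<Phi> \<omega>) = S' \<omega>"
    for R R' S S'
    unfolding cond_prob_def using that by (intro arg_cong2[where f="(/)"] prob') auto

  have pos_in: "\<forall>n\<in>{n\<^sub>0..N}. x n \<in> \<X>'"
    if "\<P>(s in P'. \<forall>n\<in>{n\<^sub>0..N}. X' n s = x n) > 0" for N x
  proof (rule ccontr)
    assume "\<not> (\<forall>n\<in>{n\<^sub>0..N}. x n \<in> \<X>')"
    then obtain n where n: "n \<in> {n\<^sub>0..N}" "x n \<notin> \<X>'"
      by blast
    have "X' n s \<noteq> x n" for s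
      using X'_in[of n s] n(2) by auto
    with n(1) have "{s \<in> space P'. \<forall>n\<in>{n\<^sub>0..N}. X' n s = x n} = {}"
      by blast
    with that show False by simp
  qed
  have path_iff: "(\<forall>n\<in>{n\<^sub>0..N}. X' n (\<Phi> \<omega>) = x n) \<longleftrightarrow> (\<forall>n\<in>{n\<^sub>0..N}. X n \<omega> = h (x n))"
    if "\<forall>n\<in>{n\<^sub>0..N}. x n \<in> \<X>'" "\<omega> \<in> space P" for N x \<omega>
    using that by (auto simp: X'\<Phi> geq XX)
  have path: "\<P>(s in P'. \<forall>n\<in>{n\<^sub>0..N}. X' n s = x n) = \<P>(\<omega> in P. \<forall>n\<in>{n\<^sub>0..N}. X n \<omega> = h (x n))"
    if "\<forall>n\<in>{n\<^sub>0..N}. x n \<in> \<X>'" for N x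
    using path_iff[OF that] by (intro prob') auto
  have single: "\<P>(s in P'. X' n s = x) = \<P>(\<omega> in P. X n \<omega> = h x)"
    if "n \<ge> n\<^sub>0" "x \<in> \<X>'" for n x
    using that by (intro prob') (auto simp: X'\<Phi> geq XX)

  have P': "prob_space P'"
    unfolding P'_def by (rule prob_space_distr) simp
  have setsP': "sets P' = sets Q"
    by (simp add: P'_def)
  have chain': "markov_chain P' n\<^sub>0 \<X>' X'"
    unfolding markov_chain_def
  proof (intro conjI allI impI)
    show "countable \<X>'" using cX by (simp add: \<X>'_def)
    show "X' n \<in> measurable P' (count_space \<X>')" for n
    proof (subst measurable_cong_sets[OF setsP' refl], rule measurable_count_space_extend[of _ UNIV])
      show "X' n \<in> space Q \<rightarrow> \<X>'" using X'_in by auto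
    qed auto
    obtain K :: "'x \<Rightarrow> 'x pmf" where K: "\<And>x. x \<in> \<X> \<Longrightarrow> set_pmf (K x) \<subseteq> \<X>"
      and KP: "\<And>N x y. N \<ge> n\<^sub>0 \<Longrightarrow> y \<in> \<X> \<Longrightarrow> \<P>(\<omega> in P. \<forall>n\<in>{n\<^sub>0..N}. X n \<omega> = x n) > 0 \<Longrightarrow>
        \<P>(\<omega> in P. X (Suc N) \<omega> = y \<bar> \<forall>n\<in>{n\<^sub>0..N}. X n \<omega> = x n) = pmf (K (x N)) y"
      using chain unfolding markov_chain_def by blast
    show "\<exists>K :: nat \<Rightarrow> nat pmf.
        (\<forall>x\<in>\<X>'. set_pmf (K x) \<subseteq> \<X>') \<and>
        (\<forall>N\<ge>n\<^sub>0. \<forall>x :: nat \<Rightarrow> nat. \<forall>y\<in>\<X>'.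
           \<P>(\<omega> in P'. \<forall>n\<in>{n\<^sub>0..N}. X' n \<omega> = x n) > 0 \<longrightarrow>
           \<P>(\<omega> in P'. X' (Suc N) \<omega> = y \<bar> \<forall>n\<in>{n\<^sub>0..N}. X' n \<omega> = x n) = pmf (K (x N)) y)"
    proof (intro exI[of _ "\<lambda>k. map_pmf g (K (h k))"] conjI ballI allI impI)
      fix k show "set_pmf (map_pmf g (K (h k))) \<subseteq> \<X>'"
        using K[OF h_in] by (auto simp: \<X>'_def)
    next
      fix N x y assume N: "n\<^sub>0 \<le> N" and y: "y \<in> \<X>'"
        and pos: "\<P>(\<omega> in P'. \<forall>n\<in>{n\<^sub>0..N}. X' n \<omega> = x n) > 0"
      note xin = pos_in[OF pos]
      have "\<P>(\<omega> in P'. X' (Suc N) \<omega> = y \<bar> \<forall>n\<in>{n\<^sub>0..N}. X' n \<omega> = x n) =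
        \<P>(\<omega> in P. X (Suc N) \<omega> = h y \<bar> \<forall>n\<in>{n\<^sub>0..N}. X n \<omega> = h (x n))"
        using N y path_iff[OF xin] by (intro cprob') (auto simp: X'\<Phi> geq XX)
      also have "\<dots> = pmf (K (h (x N))) (h y)"
        using KP[OF N h_in, of "\<lambda>n. h (x n)"] pos path[OF xin] by simp
      also have "\<dots> = pmf (map_pmf g (K (h (x N)))) (g (h y))"
      proof -
        have "inj_on g \<X>" by (rule inj_onI) (simp add: g_inj)
        then have "pmf (map_pmf g (K (h (x N)))) (g (h y)) = measure (K (h (x N))) {h y}"
          unfolding pmf_map using K[OF h_in, of "x N"] h_in[of y]
          by (intro measure_pmf.finite_measure_eq_AE)
            (auto simp: AE_measure_pmf_iff g_inj subset_eq)
        then show ?thesis by (simp add: measure_pmf_single)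
      qed
      finally show "\<P>(\<omega> in P'. X' (Suc N) \<omega> = y \<bar> \<forall>n\<in>{n\<^sub>0..N}. X' n \<omega> = x n) =
          pmf (map_pmf g (K (h (x N)))) y"
        using gh[OF y] by simp
    qed
  qed

  have ro: "\<P>(\<omega> in P'. W' n \<omega> \<in> A \<bar> X' n \<omega> = x) = \<P>(\<omega> in P. W n \<omega> \<in> A \<bar> X n \<omega> = h x)"
    if "n \<ge> n\<^sub>0" "x \<in> \<X>'" and [measurable]: "A \<in> sets borel" for n x A
    using that by (intro cprob') (auto simp: X'\<Phi> W'\<Phi> geq XX)
  have pair': "hmm_pair P' n\<^sub>0 \<X>' X' W'"
    unfolding hmm_pair_def
  proof (intro conjI allI impI)
    show "W' n \<in> borel_measurable P'" for n
      by (simp add: measurable_cong_sets[OF setsP' refl])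
    fix N and A :: "nat \<Rightarrow> 'r set" and x :: "nat \<Rightarrow> nat"
    assume N: "n\<^sub>0 \<le> N" and A: "\<forall>n. A n \<in> sets borel"
      and pos: "\<P>(\<omega> in P'. \<forall>n\<in>{n\<^sub>0..N}. X' n \<omega> = x n) > 0"
    note xin = pos_in[OF pos]
    from A have [measurable]: "A n \<in> sets borel" for n by simp
    have "\<P>(\<omega> in P'. \<forall>n\<in>{n\<^sub>0..N}. W' n \<omega> \<in> A n \<bar> \<forall>n\<in>{n\<^sub>0..N}. X' n \<omega> = x n) =
      \<P>(\<omega> in P. \<forall>n\<in>{n\<^sub>0..N}. W n \<omega> \<in> A n \<bar> \<forall>n\<in>{n\<^sub>0..N}. X n \<omega> = h (x n))"
      using N path_iff[OF xin] by (intro cprob') (auto simp: W'\<Phi>)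
    also have "\<dots> = (\<Prod>n\<in>{n\<^sub>0..N}. \<P>(\<omega> in P. W n \<omega> \<in> A n \<bar> X n \<omega> = h (x n)))"
    proof -
      have "\<P>(\<omega> in P. \<forall>n\<in>{n\<^sub>0..N}. X n \<omega> = h (x n)) > 0"
        using pos path[OF xin] by simp
      then show ?thesis
        using pair[unfolded hmm_pair_def, THEN conjunct2, THEN conjunct2, THEN conjunct2,
            THEN conjunct1, rule_format, OF N, of A "\<lambda>n. h (x n)"] A by simp
    qed
    also have "\<dots> = (\<Prod>n\<in>{n\<^sub>0..N}. \<P>(\<omega> in P'. W' n \<omega> \<in> A n \<bar> X' n \<omega> = x n))"
      using xin A by (intro prod.cong refl ro[symmetric]) auto
    finally show "\<P>(\<omega> in P'. \<forall>n\<in>{n\<^sub>0..N}. W' n \<omega> \<in> A n \<bar> \<forall>n\<in>{n\<^sub>0..N}. X' n \<omega> = x n) =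
        (\<Prod>n\<in>{n\<^sub>0..N}. \<P>(\<omega> in P'. W' n \<omega> \<in> A n \<bar> X' n \<omega> = x n))" .
  next
    obtain f :: "'x \<Rightarrow> 'r measure" where
      f: "\<And>x. x \<in> \<X> \<Longrightarrow> prob_space (f x) \<and> sets (f x) = sets borel"
        "\<And>n x A. n \<ge> n\<^sub>0 \<Longrightarrow> x \<in> \<X> \<Longrightarrow> A \<in> sets borel \<Longrightarrow> \<P>(\<omega> in P. X n \<omega> = x) > 0 \<Longrightarrow>
           \<P>(\<omega> in P. W n \<omega> \<in> A \<bar> X n \<omega> = x) = measure (f x) A"
      using pair[unfolded hmm_pair_def, THEN conjunct2, THEN conjunct2, THEN conjunct2,
          THEN conjunct2] by blast
    show "\<exists>f :: nat \<Rightarrow> 'r measure.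
        (\<forall>x\<in>\<X>'. prob_space (f x) \<and> sets (f x) = sets borel) \<and>
        (\<forall>n\<ge>n\<^sub>0. \<forall>x\<in>\<X>'. \<forall>A\<in>sets borel.
           \<P>(\<omega> in P'. X' n \<omega> = x) > 0 \<longrightarrow>
           \<P>(\<omega> in P'. W' n \<omega> \<in> A \<bar> X' n \<omega> = x) = measure (f x) A)"
      using f h_in by (intro exI[of _ "\<lambda>k. f (h k)"]) (simp add: ro single)
  qed (rule P' chain')+

  have recur': "recurrent_chain P' n\<^sub>0 \<X>' X'"
    unfolding recurrent_chain_def
  proof (intro ballI impI)
    fix x assume x: "x \<in> \<X>'" and pos: "\<P>(\<omega> in P'. X' n\<^sub>0 \<omega> = x) > 0"
    have "\<P>(\<omega> in P'. infinite {n. n \<ge> n\<^sub>0 \<and> X' n \<omega> = x} \<bar> X' n\<^sub>0 \<omega> = x) =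
      \<P>(\<omega> in P. infinite {n. n \<ge> n\<^sub>0 \<and> X n \<omega> = h x} \<bar> X n\<^sub>0 \<omega> = h x)"
    proof (rule cprob')
      show "Measurable.pred Q (\<lambda>\<omega>. infinite {n. n \<ge> n\<^sub>0 \<and> X' n \<omega> = x})"
        unfolding infinite_nat_iff_unbounded_le mem_Collect_eq by measurable
      show "infinite {n. n \<ge> n\<^sub>0 \<and> X' n (\<Phi> \<omega>) = x} = infinite {n. n \<ge> n\<^sub>0 \<and> X n \<omega> = h x}"
        if "\<omega> \<in> space P" for \<omega>
        using that x by (simp add: X'\<Phi> geq XX cong: conj_cong)
    qed (use x in \<open>auto simp: X'\<Phi> geq XX\<close>)
    also have "\<dots> = 1"
      using recur h_in pos single[OF le_refl x] unfolding recurrent_chain_def by simp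
    finally show "\<P>(\<omega> in P'. infinite {n. n \<ge> n\<^sub>0 \<and> X' n \<omega> = x} \<bar> X' n\<^sub>0 \<omega> = x) = 1" .
  qed

  have fdd': "same_fdd n\<^sub>0 M Z P' W'"
    unfolding same_fdd_def
  proof (intro allI impI)
    fix J :: "nat set" assume J: "finite J \<and> J \<subseteq> {n\<^sub>0..}"
    have "distr P' (\<Pi>\<^sub>M n\<in>J. borel) (\<lambda>\<omega>. \<lambda>n\<in>J. W' n \<omega>) =
      distr P (\<Pi>\<^sub>M n\<in>J. borel) ((\<lambda>\<omega>. \<lambda>n\<in>J. W' n \<omega>) \<circ> \<Phi>)"
      unfolding P'_def by (rule distr_distr) measurable
    also have "\<dots> = distr P (\<Pi>\<^sub>M n\<in>J. borel) (\<lambda>\<omega>. \<lambda>n\<in>J. W n \<omega>)"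
      using J by (intro distr_cong refl) (auto simp: W'\<Phi> subset_eq)
    finally show "distr M (\<Pi>\<^sub>M n\<in>J. borel) (\<lambda>\<omega>. \<lambda>n\<in>J. Z n \<omega>) =
        distr P' (\<Pi>\<^sub>M n\<in>J. borel) (\<lambda>\<omega>. \<lambda>n\<in>J. W' n \<omega>)"
      using fdd J unfolding same_fdd_def by simp
  qed
  show ?thesis
    unfolding recurrent_hmm_def using Z pair' recur' fdd' by blast
qed

definition visit_times :: "(nat \<Rightarrow> 's option set) \<Rightarrow> (nat \<Rightarrow> 'w \<Rightarrow> 's) \<Rightarrow> nat \<Rightarrow> 'w \<Rightarrow> nat set" where
  "visit_times E Y j \<omega> = {t. Some (Y t \<omega>) \<in> E j}"

text \<open>\<^const>\<open>enumerate\<close> counts from 0, so the \<open>n\<close>-th visit takes place at time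
  \<open>enumerate (visit_times E Y j \<omega>) (n - 1)\<close>. Only \<open>n \<ge> 1\<close> is meaningful.\<close>

definition successors ::
    "(nat \<Rightarrow> 's option set) \<Rightarrow> (nat \<Rightarrow> 'w \<Rightarrow> 's) \<Rightarrow> nat \<Rightarrow> nat \<Rightarrow> 'w \<Rightarrow> 's option" where
  "successors E Y j n \<omega> =
     (let T = visit_times E Y j \<omega> in
      if infinite T \<or> n \<le> card T then Some (Y (Suc (enumerate T (n - 1))) \<omega>) else None)"

end

theory Submission
  imports Defs
begin

text \<open>Fix \<open>j\<close> and enlarge the state \<open>X\<^sub>t\<close> of the underlying chain by the flag telling whether the
  observation \<open>W\<^sub>t\<close> lies in \<open>E\<^sub>j\<close>; conditioning the read-out distributions on the flag gives a
  hidden Markov model for the same observations in which the visits to \<open>E\<^sub>j\<close> are visits of the chain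
  to a set \<open>D\<close> of states. If \<open>\<tau>\<^sub>n\<close> is the \<open>n\<close>-th such visit, the states at the times \<open>\<tau>\<^sub>n + 1\<close>,
  together with an absorbing state for \<open>\<tau>\<^sub>n = \<infinity>\<close>, form a Markov chain \<open>U\<close> by the strong Markov
  property, and the successors \<open>V\<^sub>n\<close>, the observations at \<open>\<tau>\<^sub>n + 1\<close>, are read out from it.

  For recurrence: if the chain ever makes a transition from \<open>a\<close> to \<open>b\<close>, then it is in \<open>a\<close> infinitely
  often, and by a conditional Borel-Cantelli argument it makes this transition infinitely often.
  Applied to \<open>a = X\<close> at time \<open>\<tau>\<^sub>1\<close> and \<open>b = U\<^sub>1\<close>, each repetition is a visit of \<open>U\<close> to \<open>U\<^sub>1\<close>.\<close>

section \<open>Enumerating visits\<close>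

text \<open>A row of the successors array detached from \<open>Y\<close> and \<open>E\<close>: only
  a set of times and a path enter, so the same function applies to the observations and to the
  states of the chain.\<close>

definition after_visit :: "nat set \<Rightarrow> (nat \<Rightarrow> 'a) \<Rightarrow> nat \<Rightarrow> 'a option" where
  "after_visit T z n =
     (if infinite T \<or> n \<le> card T then Some (z (Suc (enumerate T (n - 1)))) else None)"

lemma successors_eq_after_visit:
  "successors E Y j n \<omega> = after_visit (visit_times E Y j \<omega>) (\<lambda>t. Y t \<omega>) n"
  by (simp add: successors_def after_visit_def Let_def)

text \<open>Visits are counted from 0 here, but from 1 in \<^const>\<open>after_visit\<close>.\<close>

definition is_visit :: "nat set \<Rightarrow> nat \<Rightarrow> nat \<Rightarrow> bool" where
  "is_visit T n t \<longleftrightarrow> t \<in> T \<and> card {s \<in> T. s < t} = n"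

lemma is_visit_less:
  assumes "is_visit T m s" "is_visit T n t" "s < t"
  shows "m < n"
proof -
  have "{r \<in> T. r < s} \<subset> {r \<in> T. r < t}"
    using assms by (auto simp: is_visit_def)
  then show ?thesis
    using psubset_card_mono[of "{r \<in> T. r < t}" "{r \<in> T. r < s}"] assms
    by (simp add: is_visit_def)
qed

lemma is_visit_unique:
  assumes "is_visit T n s" "is_visit T n t"
  shows "s = t"
  using is_visit_less[OF assms] is_visit_less[OF assms(2,1)] by (meson less_irrefl linorder_neqE_nat)

text \<open>The elements of \<open>T\<close> below \<open>enumerate T n\<close> are exactly the
  values of the enumeration at the indices below \<open>n\<close>. The hypothesis also covers finite
  \<open>T\<close>, where the enumeration is strictly increasing only as far as the elements
  last.\<close>

lemma is_visit_enumerate: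
  assumes "infinite T \<or> n < card T"
  shows "is_visit T n (enumerate T n)"
proof -
  have mem: "enumerate T k \<in> T" if "k \<le> n" for k
    using assms that finite_enumerate_in_set[of T k] enumerate_in_set[of T k] by (cases "finite T") auto
  have mono: "enumerate T k < enumerate T l" if "k < l" "l \<le> n" for k l
    using assms that enumerate_mono[of k l T] finite_enumerate_mono[of k l T]
    by (cases "finite T") auto
  have "{s \<in> T. s < enumerate T n} = enumerate T ` {..<n}"
  proof (intro equalityI subsetI)
    fix s assume s: "s \<in> {s \<in> T. s < enumerate T n}"
    obtain k where k: "s = enumerate T k" "infinite T \<or> k < card T"
      using s enumerate_Ex[of T s] finite_enumerate_Ex[of T s] by (cases "finite T") auto
    have "k < n"
    proof (rule ccontr)
      assume "\<not> k < n"
      then have "enumerate T n \<le> enumerate T k"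
        using k(2) enumerate_mono[of n k T] finite_enumerate_mono[of n k T]
        by (cases "n = k"; cases "finite T") (auto simp: order.order_iff_strict)
      with s k(1) show False by simp
    qed
    then show "s \<in> enumerate T ` {..<n}"
      using k(1) by blast
  qed (use mem mono in auto)
  moreover have "inj_on (enumerate T) {..<n}"
    by (rule linorder_inj_onI) (use mono in \<open>force+\<close>)
  ultimately show ?thesis
    using mem[of n] by (simp add: is_visit_def card_image)
qed

lemma is_visit_card:
  assumes "is_visit T n t"
  shows "infinite T \<or> n < card T"
proof (rule disjCI)
  assume "\<not> n < card T"
  then show "infinite T"
    using assms psubset_card_mono[of T "{s \<in> T. s < t}"] unfolding is_visit_def by auto
qed

lemma ex_is_visit_iff: "(\<exists>t. is_visit T n t) \<longleftrightarrow> infinite T \<or> n < card T"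
  using is_visit_card is_visit_enumerate by blast

lemma is_visit_earlier:
  assumes "is_visit T n t" "m < n"
  shows "\<exists>s<t. is_visit T m s"
proof -
  obtain s where s: "is_visit T m s"
    using assms ex_is_visit_iff[of T m] ex_is_visit_iff[of T n] by auto
  have "s < t"
    using is_visit_less[OF assms(1) s] s assms by (metis is_visit_def linorder_neqE_nat not_less_iff_gr_or_eq)
  with s show ?thesis by blast
qed

text \<open>An element of \<open>T\<close> strictly between \<open>t\<close> and \<open>u\<close>
  would be a visit numbered strictly between \<open>n\<close> and \<open>Suc n\<close>. The count of
  all earlier visits is thereby replaced by a condition on the times after \<open>t\<close>, the
  form in which the Markov property can be applied.\<close>

lemma is_visit_Suc_iff:
  assumes "is_visit T n t"
  shows "is_visit T (Suc n) u \<longleftrightarrow> u \<in> T \<and> t < u \<and> (\<forall>s. t < s \<and> s < u \<longrightarrow> s \<notin> T)"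
proof
  assume u: "is_visit T (Suc n) u"
  have tu: "t < u"
    using is_visit_less[OF u assms] u assms by (metis Suc_n_not_n is_visit_def linorder_neqE_nat not_less_eq not_less_iff_gr_or_eq)
  have "s \<notin> T" if "t < s" "s < u" for s
  proof
    assume "s \<in> T"
    then have "is_visit T (card {r \<in> T. r < s}) s" by (simp add: is_visit_def)
    from is_visit_less[OF assms this that(1)] is_visit_less[OF this u that(2)] show False by simp
  qed
  with u tu show "u \<in> T \<and> t < u \<and> (\<forall>s. t < s \<and> s < u \<longrightarrow> s \<notin> T)"
    by (auto simp: is_visit_def)
next
  assume u: "u \<in> T \<and> t < u \<and> (\<forall>s. t < s \<and> s < u \<longrightarrow> s \<notin> T)"
  then have "{s \<in> T. s < u} = insert t {s \<in> T. s < t}"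
    using assms by (auto simp: is_visit_def) (metis linorder_neqE_nat)
  then show "is_visit T (Suc n) u"
    using assms u by (simp add: is_visit_def)
qed

lemma after_visit_Suc:
  assumes "is_visit T n t"
  shows "after_visit T z (Suc n) = Some (z (Suc t))"
  using is_visit_card[OF assms] is_visit_unique[OF assms is_visit_enumerate]
  by (auto simp: after_visit_def)

lemma after_visit_Suc_None:
  "after_visit T z (Suc n) = None \<longleftrightarrow> (\<nexists>t. is_visit T n t)"
  unfolding ex_is_visit_iff by (auto simp: after_visit_def)

lemma after_visit_Suc_Some:
  "after_visit T z (Suc n) = Some y \<longleftrightarrow> (\<exists>t. is_visit T n t \<and> z (Suc t) = y)"
  by (metis after_visit_Suc after_visit_Suc_None not_Some_eq option.inject)

text \<open>Measurability is asked for times up to \<open>t\<close> only. With the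
  \<open>\<sigma>\<close>-algebra of the past for \<open>M\<close>, this makes the visit times
  stopping times.\<close>

lemma pred_is_visit:
  assumes "\<And>s. s \<le> t \<Longrightarrow> Measurable.pred M (\<lambda>x. s \<in> T x)"
  shows "Measurable.pred M (\<lambda>x. is_visit (T x) n t)"
proof -
  have "{x \<in> space M. i \<in> {s \<in> T x. s < t}} \<in> sets M" for i
    using assms[of i] by (cases "i < t") (auto simp: pred_def)
  then have "(\<lambda>x. card {s \<in> T x. s < t}) \<in> measurable M (count_space UNIV)"
    by (rule measurable_card)
  then have "Measurable.pred M (\<lambda>x. card {s \<in> T x. s < t} = n)"
    by (rule measurable_compose) simp
  then show ?thesis
    unfolding is_visit_def by (intro pred_intros_logic assms order_refl)
qed

text \<open>A preimage splits over the countably many possible times of the visit, with the event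
  that the visit never takes place as a separate piece. \<open>N\<close> and \<open>N'\<close> are
  left abstract to cover discrete states as well as observations.\<close>

lemma measurable_after_visit:
  assumes T: "\<And>t. Measurable.pred M (\<lambda>x. t \<in> T x)" and z: "\<And>t. z t \<in> measurable M N"
    and N': "\<And>C. C \<in> sets N' \<Longrightarrow> Some -` C \<in> sets N" "space N' = UNIV"
  shows "(\<lambda>x. after_visit (T x) (\<lambda>t. z t x) (Suc n)) \<in> measurable M N'"
proof (rule measurableI)
  fix C assume "C \<in> sets N'"
  note [measurable] = N'(1)[OF this] z pred_is_visit[OF T]
  have "after_visit (T x) (\<lambda>t. z t x) (Suc n) \<in> C \<longleftrightarrow>
    (\<exists>t. is_visit (T x) n t \<and> z (Suc t) x \<in> Some -` C) \<or> None \<in> C \<and> (\<forall>t. \<not> is_visit (T x) n t)" for x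
  proof (cases "\<exists>t. is_visit (T x) n t")
    case True
    then obtain t where t: "is_visit (T x) n t" ..
    then have "is_visit (T x) n s \<longleftrightarrow> s = t" for s
      using is_visit_unique by blast
    then show ?thesis by (simp add: after_visit_Suc[OF t])
  next
    case False
    then show ?thesis
      using after_visit_Suc_None[of "T x" "\<lambda>t. z t x" n] by simp
  qed
  then have "(\<lambda>x. after_visit (T x) (\<lambda>t. z t x) (Suc n)) -` C \<inter> space M = {x \<in> space M.
    (\<exists>t. is_visit (T x) n t \<and> z (Suc t) x \<in> Some -` C) \<or> None \<in> C \<and> (\<forall>t. \<not> is_visit (T x) n t)}"
    by auto
  also have "\<dots> \<in> sets M" by measurable
  finally show "(\<lambda>x. after_visit (T x) (\<lambda>t. z t x) (Suc n)) -` C \<inter> space M \<in> sets M" .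
qed (simp add: N')

text \<open>Sending a visit time to its number is injective, so infinitely many times yield
  infinitely many indices. The \<open>Suc\<close> in \<open>c\<close> shifts to the count from 1 of
  \<open>after_visit\<close>.\<close>

lemma infinite_after_visit:
  assumes "infinite {t \<in> T. z (Suc t) = y}"
  shows "infinite {n. 1 \<le> n \<and> after_visit T z n = Some y}"
proof -
  define c where "c t = Suc (card {s \<in> T. s < t})" for t
  have v: "is_visit T (card {s \<in> T. s < t}) t" if "t \<in> T" for t
    using that by (simp add: is_visit_def)
  have "inj_on c {t \<in> T. z (Suc t) = y}"
  proof (rule inj_onI)
    fix s t assume "s \<in> {t \<in> T. z (Suc t) = y}" "t \<in> {t \<in> T. z (Suc t) = y}" "c s = c t"
    then show "s = t"
      using v[of s] v[of t] is_visit_unique[of T _ s t] by (simp add: c_def)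
  qed
  then have "infinite (c ` {t \<in> T. z (Suc t) = y})"
    using assms finite_imageD by blast
  moreover have "c ` {t \<in> T. z (Suc t) = y} \<subseteq> {n. 1 \<le> n \<and> after_visit T z n = Some y}"
    using v by (auto simp: c_def after_visit_Suc)
  ultimately show ?thesis
    using finite_subset by blast
qed

section \<open>Probabilistic preliminaries\<close>

text \<open>Countable additivity, with the sum written as an integral over a counting measure so
  that factors independent of the index can be pulled out for any countable index type.\<close>

lemma emeasure_split:
  fixes R :: "'i::countable \<Rightarrow> 'a \<Rightarrow> bool"
  assumes "\<And>i. {x \<in> space M. R i x} \<in> sets M"
    and "\<And>x. x \<in> space M \<Longrightarrow> Q x \<longleftrightarrow> (\<exists>i. R i x)"
    and "\<And>i j x. x \<in> space M \<Longrightarrow> R i x \<Longrightarrow> R j x \<Longrightarrow> i = j"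
  shows "emeasure M {x \<in> space M. Q x} =
    (\<integral>\<^sup>+i. emeasure M {x \<in> space M. R i x} \<partial>count_space UNIV)"
proof -
  have "{x \<in> space M. Q x} = (\<Union>i. {x \<in> space M. R i x})"
    using assms(2) by auto
  then show ?thesis
    using assms by (simp, intro emeasure_UN_countable) (auto simp: disjoint_family_on_def)
qed

text \<open>A conditional Borel-Cantelli lemma: a trial \<open>C t\<close> succeeds with the same
  probability \<open>p\<close> given any past in \<open>F t\<close>, and its outcome
  \<open>B t\<close> is known one step later. For fixed \<open>n\<close>, first successes from
  \<open>n\<close> on are disjoint events, so the probabilities of the trials not preceded by such a
  success have a finite sum. Almost surely only finitely many of these trials occur, which rules out
  infinitely many trials without success from \<open>n\<close> on.\<close>

lemma (in prob_space) AE_infinitely_often_transfer: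
  fixes F :: "nat \<Rightarrow> 'a measure" and C B :: "nat \<Rightarrow> 'a \<Rightarrow> bool" and p :: ennreal
  assumes space: "\<And>t. space (F t) = space M" and sub: "\<And>t. sets (F t) \<subseteq> sets M"
    and mono: "\<And>s t. s \<le> t \<Longrightarrow> sets (F s) \<subseteq> sets (F t)"
    and C: "\<And>t. Measurable.pred (F t) (C t)"
    and B: "\<And>t. Measurable.pred (F (Suc t)) (B t)"
    and p: "p > 0"
    and step: "\<And>t Q. Measurable.pred (F t) Q \<Longrightarrow>
      emeasure M {x \<in> space M. Q x \<and> C t x \<and> B t x} = emeasure M {x \<in> space M. Q x \<and> C t x} * p"
  shows "AE x in M. infinite {t. C t x} \<longrightarrow> infinite {t. C t x \<and> B t x}"
proof -
  have F: "Measurable.pred (F t) Q" if "Measurable.pred (F s) Q" "s \<le> t" for s t Q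
    using that space mono[OF that(2)] by (auto simp: pred_def)
  have FM: "Measurable.pred M Q" if "Measurable.pred (F s) Q" for s Q
    using that space sub[of s] by (auto simp: pred_def)
  have [measurable]: "Measurable.pred M (C t)" "Measurable.pred M (B t)" for t
    using FM[OF C] FM[OF B] by auto
  have "AE x in M. \<not> (infinite {t. C t x} \<and> (\<forall>t\<ge>n. \<not> (C t x \<and> B t x)))" for n
  proof -
    \<comment> \<open>No trial from \<open>n\<close> up to but excluding \<open>t\<close> has
      succeeded; since the outcome of trial \<open>s\<close> is known at \<open>Suc s\<close>, this
      belongs to the past \<open>F t\<close>.\<close>
    define Q where "Q t x \<longleftrightarrow> n \<le> t \<and> (\<forall>s\<in>{n..<t}. \<not> (C s x \<and> B s x))" for t x
    have QF: "Measurable.pred (F t) (Q t)" for t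
    proof -
      have [measurable]: "Measurable.pred (F t) (C s)" "Measurable.pred (F t) (B s)" if "s \<in> {n..<t}" for s
        using that by (auto intro: F[OF C] F[OF B])
      show ?thesis unfolding Q_def by measurable
    qed
    have [measurable]: "Measurable.pred M (Q t)" for t
      by (rule FM[OF QF])
    define D where "D t = {x \<in> space M. Q t x \<and> C t x}" for t
    have [measurable]: "D t \<in> sets M" for t
      unfolding D_def by measurable
    have "(\<integral>\<^sup>+t. emeasure M (D t) \<partial>count_space UNIV) * p =
      (\<integral>\<^sup>+t. emeasure M {x \<in> space M. Q t x \<and> C t x \<and> B t x} \<partial>count_space UNIV)"
      unfolding D_def by (simp add: step[OF QF] nn_integral_multc)
    also have "\<dots> = emeasure M {x \<in> space M. \<exists>t. Q t x \<and> C t x \<and> B t x}"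
    proof (rule emeasure_split[symmetric])
      fix s t x assume "Q s x \<and> C s x \<and> B s x" "Q t x \<and> C t x \<and> B t x"
      then show "s = t"
        unfolding Q_def by (cases s t rule: linorder_cases) auto
    qed auto
    also have "\<dots> \<le> 1" by (rule emeasure_le_1)
    finally have "(\<integral>\<^sup>+t. emeasure M (D t) \<partial>count_space UNIV) < \<infinity>"
      using p by (cases "(\<integral>\<^sup>+t. emeasure M (D t) \<partial>count_space UNIV) = \<infinity>")
        (auto simp: ennreal_top_mult less_top top_unique split: if_splits)
    then have "(\<Sum>t. ennreal (measure M (D t))) \<noteq> \<infinity>"
      by (simp add: nn_integral_count_space_nat emeasure_eq_measure)
    then have "summable (\<lambda>t. measure M (D t))"
      by (intro summable_suminf_not_top) auto
    then have "AE x in M. \<forall>\<^sub>F t in sequentially. x \<in> space M - D t"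
      by (intro borel_cantelli_AE1) (auto simp: emeasure_eq_measure)
    then show ?thesis
    proof (rule AE_mp, intro AE_I2 impI notI)
      fix x assume x: "x \<in> space M" "\<forall>\<^sub>F t in sequentially. x \<in> space M - D t"
        "infinite {t. C t x} \<and> (\<forall>t\<ge>n. \<not> (C t x \<and> B t x))"
      then obtain m where m: "\<And>t. t \<ge> m \<Longrightarrow> x \<notin> D t"
        by (auto simp: eventually_sequentially)
      obtain t where "t \<ge> max m n" "C t x"
        using x(3) unfolding infinite_nat_iff_unbounded_le by blast
      with x m[of t] show False
        by (auto simp: D_def Q_def)
    qed
  qed
  then have "AE x in M. \<forall>n. \<not> (infinite {t. C t x} \<and> (\<forall>t\<ge>n. \<not> (C t x \<and> B t x)))"
    by (rule AE_all_countable[THEN iffD2, rule_format])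
  then show ?thesis
    by eventually_elim (simp only: infinite_nat_iff_unbounded_le mem_Collect_eq, blast)
qed

lemma ex_pmf_ennreal:
  fixes q :: "'a \<Rightarrow> ennreal"
  assumes "(\<integral>\<^sup>+y. q y \<partial>count_space UNIV) = 1"
  shows "\<exists>p. \<forall>y. ennreal (pmf p y) = q y"
proof -
  have "q y \<le> 1" for y
    using nn_integral_ge_point[of y UNIV q] assms by simp
  then have q: "ennreal (enn2real (q y)) = q y" for y
    by (intro ennreal_enn2real) (metis ennreal_one_less_top order_le_less_trans)
  have "pmf (embed_pmf (\<lambda>y. enn2real (q y))) y = enn2real (q y)" for y
    by (rule pmf_embed_pmf) (simp_all add: q assms)
  with q show ?thesis by metis
qed

text \<open>A criterion free of conditional probabilities. Histories carry both states and
  observations, so alternating \<open>readout\<close> and \<open>trans\<close> yields the product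
  formula for the joint law by induction; \<open>readout_single\<close> supplies the law of an
  observation given the current state alone.\<close>

lemma hmm_pairI:
  fixes U :: "nat \<Rightarrow> 'w \<Rightarrow> 'u::countable" and V :: "nat \<Rightarrow> 'w \<Rightarrow> 'r::polish_space"
    and q :: "'u \<Rightarrow> 'u \<Rightarrow> ennreal"
  assumes P: "prob_space P"
    and U: "\<And>n. n \<ge> n\<^sub>0 \<Longrightarrow> U n \<in> measurable P (count_space UNIV)"
    and V: "\<And>n. n \<ge> n\<^sub>0 \<Longrightarrow> V n \<in> borel_measurable P"
    and g: "\<And>u. prob_space (g u)" "\<And>u. sets (g u) = sets borel"
    and trans: "\<And>N x A y. N \<ge> n\<^sub>0 \<Longrightarrow> (\<And>n. A n \<in> sets borel) \<Longrightarrow>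
      emeasure P {\<omega> \<in> space P. (\<forall>n\<in>{n\<^sub>0..N}. U n \<omega> = x n \<and> V n \<omega> \<in> A n) \<and> U (Suc N) \<omega> = y} =
      emeasure P {\<omega> \<in> space P. \<forall>n\<in>{n\<^sub>0..N}. U n \<omega> = x n \<and> V n \<omega> \<in> A n} * q (x N) y"
    and readout: "\<And>N x A y B. N \<ge> n\<^sub>0 \<Longrightarrow> (\<And>n. A n \<in> sets borel) \<Longrightarrow> B \<in> sets borel \<Longrightarrow>
      emeasure P {\<omega> \<in> space P. (\<forall>n\<in>{n\<^sub>0..<N}. U n \<omega> = x n \<and> V n \<omega> \<in> A n) \<and> U N \<omega> = y \<and> V N \<omega> \<in> B} =
      emeasure P {\<omega> \<in> space P. (\<forall>n\<in>{n\<^sub>0..<N}. U n \<omega> = x n \<and> V n \<omega> \<in> A n) \<and> U N \<omega> = y} * emeasure (g y) B"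
    and readout_single: "\<And>N y B. N \<ge> n\<^sub>0 \<Longrightarrow> B \<in> sets borel \<Longrightarrow>
      emeasure P {\<omega> \<in> space P. U N \<omega> = y \<and> V N \<omega> \<in> B} =
      emeasure P {\<omega> \<in> space P. U N \<omega> = y} * emeasure (g y) B"
  shows "hmm_pair P n\<^sub>0 UNIV U V"
proof -
  interpret prob_space P by (rule P)
  have gm: "emeasure (g y) B = ennreal (measure (g y) B)" for y B
    using g by (simp add: finite_measure.emeasure_eq_measure prob_space.finite_measure)
  have single: "\<P>(\<omega> in P. V n \<omega> \<in> B \<bar> U n \<omega> = y) = measure (g y) B"
    if "n \<ge> n\<^sub>0" "B \<in> sets borel" "\<P>(\<omega> in P. U n \<omega> = y) > 0" for n y B
  proof -
    have "\<P>(\<omega> in P. U n \<omega> = y \<and> V n \<omega> \<in> B) = \<P>(\<omega> in P. U n \<omega> = y) * measure (g y) B"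
      using readout_single[OF that(1,2), of y]
      by (simp add: emeasure_eq_measure gm ennreal_mult[symmetric])
    then show ?thesis
      using that(3) by (simp add: cond_prob_def conj_commute)
  qed
  define cyl where "cyl N x A = emeasure P {\<omega> \<in> space P. \<forall>n\<in>{n\<^sub>0..N}. U n \<omega> = x n \<and> V n \<omega> \<in> A n}"
    for N x and A :: "nat \<Rightarrow> 'r set"
  \<comment> \<open>Taking all sets of observations to be \<open>UNIV\<close> leaves the transition
    law of the states alone.\<close>
  have trans': "emeasure P {\<omega> \<in> space P. (\<forall>n\<in>{n\<^sub>0..N}. U n \<omega> = x n) \<and> U (Suc N) \<omega> = y} =
      emeasure P {\<omega> \<in> space P. \<forall>n\<in>{n\<^sub>0..N}. U n \<omega> = x n} * q (x N) y" if "N \<ge> n\<^sub>0" for N x y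
    using trans[OF that, of "\<lambda>_. UNIV"] by simp
  have cyl_eq: "cyl N x A = emeasure P {\<omega> \<in> space P. \<forall>n\<in>{n\<^sub>0..N}. U n \<omega> = x n} *
      (\<Prod>n\<in>{n\<^sub>0..N}. emeasure (g (x n)) (A n))"
    if N: "N \<ge> n\<^sub>0" and A: "\<And>n. A n \<in> sets borel" for N x A
    using N
  proof (induction N rule: dec_induct)
    case base
    show ?case
      using readout_single[OF le_refl A, of "x n\<^sub>0"] by (simp add: cyl_def)
  next
    case (step N)
    have *: "{n\<^sub>0..<Suc N} = {n\<^sub>0..N}" and **: "{n\<^sub>0..Suc N} = insert (Suc N) {n\<^sub>0..N}"
      using step by auto
    have "cyl (Suc N) x A = emeasure P {\<omega> \<in> space P.
        (\<forall>n\<in>{n\<^sub>0..<Suc N}. U n \<omega> = x n \<and> V n \<omega> \<in> A n) \<and> U (Suc N) \<omega> = x (Suc N) \<and> V (Suc N) \<omega> \<in> A (Suc N)}"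
      unfolding cyl_def * ** by (intro arg_cong[where f="emeasure P"]) auto
    also have "\<dots> = cyl N x A * q (x N) (x (Suc N)) * emeasure (g (x (Suc N))) (A (Suc N))"
      using step(1) trans[OF step(1) A] unfolding cyl_def *[symmetric]
      by (subst readout[OF _ A A]) (auto simp: *)
    also have "\<dots> = emeasure P {\<omega> \<in> space P. (\<forall>n\<in>{n\<^sub>0..N}. U n \<omega> = x n) \<and> U (Suc N) \<omega> = x (Suc N)} *
      (\<Prod>n\<in>{n\<^sub>0..Suc N}. emeasure (g (x n)) (A n))"
      unfolding step.IH trans'[OF step(1)] ** by (simp add: mult_ac)
    finally show ?case
      unfolding ** by (simp add: conj_commute)
  qed
  show ?thesis
    unfolding hmm_pair_def
  proof (intro conjI allI impI)
    fix N and A :: "nat \<Rightarrow> 'r set" and x :: "nat \<Rightarrow> 'u"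
    assume N: "n\<^sub>0 \<le> N" and A: "\<forall>n. A n \<in> sets borel"
      and pos: "\<P>(\<omega> in P. \<forall>n\<in>{n\<^sub>0..N}. U n \<omega> = x n) > 0"
    have pos_single: "\<P>(\<omega> in P. U n \<omega> = x n) > 0" if "n \<in> {n\<^sub>0..N}" for n
    proof -
      have [measurable]: "U n \<in> measurable P (count_space UNIV)"
        using U that by simp
      have "\<P>(\<omega> in P. \<forall>n\<in>{n\<^sub>0..N}. U n \<omega> = x n) \<le> \<P>(\<omega> in P. U n \<omega> = x n)"
        using that by (intro finite_measure_mono) auto
      with pos show ?thesis by simp
    qed
    have "\<P>(\<omega> in P. (\<forall>n\<in>{n\<^sub>0..N}. V n \<omega> \<in> A n) \<and> (\<forall>n\<in>{n\<^sub>0..N}. U n \<omega> = x n)) =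
      \<P>(\<omega> in P. (\<forall>n\<in>{n\<^sub>0..N}. U n \<omega> = x n)) * (\<Prod>n\<in>{n\<^sub>0..N}. measure (g (x n)) (A n))"
    proof -
      have "(\<forall>n\<in>{n\<^sub>0..N}. V n \<omega> \<in> A n) \<and> (\<forall>n\<in>{n\<^sub>0..N}. U n \<omega> = x n) \<longleftrightarrow>
        (\<forall>n\<in>{n\<^sub>0..N}. U n \<omega> = x n \<and> V n \<omega> \<in> A n)" for \<omega> by auto
      then show ?thesis
        using cyl_eq[OF N, of A x] A
        by (simp add: cyl_def emeasure_eq_measure gm prod_ennreal ennreal_mult[symmetric] prod_nonneg)
    qed
    then have "\<P>(\<omega> in P. \<forall>n\<in>{n\<^sub>0..N}. V n \<omega> \<in> A n \<bar> \<forall>n\<in>{n\<^sub>0..N}. U n \<omega> = x n) =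
      (\<Prod>n\<in>{n\<^sub>0..N}. measure (g (x n)) (A n))"
      using pos by (simp add: cond_prob_def)
    also have "\<dots> = (\<Prod>n\<in>{n\<^sub>0..N}. \<P>(\<omega> in P. V n \<omega> \<in> A n \<bar> U n \<omega> = x n))"
      using A pos_single by (intro prod.cong refl single[symmetric]) auto
    finally show "\<P>(\<omega> in P. \<forall>n\<in>{n\<^sub>0..N}. V n \<omega> \<in> A n \<bar> \<forall>n\<in>{n\<^sub>0..N}. U n \<omega> = x n) =
      (\<Prod>n\<in>{n\<^sub>0..N}. \<P>(\<omega> in P. V n \<omega> \<in> A n \<bar> U n \<omega> = x n))" .
  next
    show "\<exists>f :: 'u \<Rightarrow> 'r measure. (\<forall>x\<in>UNIV. prob_space (f x) \<and> sets (f x) = sets borel) \<and>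
        (\<forall>n\<ge>n\<^sub>0. \<forall>x\<in>UNIV. \<forall>A\<in>sets borel. \<P>(\<omega> in P. U n \<omega> = x) > 0 \<longrightarrow>
           \<P>(\<omega> in P. V n \<omega> \<in> A \<bar> U n \<omega> = x) = measure (f x) A)"
      using g single by (intro exI[of _ g]) auto
  next
    show "markov_chain P n\<^sub>0 UNIV U"
      unfolding markov_chain_def
    proof (intro conjI allI impI)
      \<comment> \<open>The rows of \<open>q\<close> are not assumed to have mass one. For a row
        that is not a probability distribution \<open>K u\<close> is arbitrary; the argument below
        shows that such a \<open>u\<close> does not end a history of positive probability.\<close>
      define K where "K u = (SOME p. \<forall>y. ennreal (pmf p y) = q u y)" for u
      show "\<exists>K :: 'u \<Rightarrow> 'u pmf. (\<forall>x\<in>UNIV. set_pmf (K x) \<subseteq> UNIV) \<and>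
        (\<forall>N\<ge>n\<^sub>0. \<forall>x :: nat \<Rightarrow> 'u. \<forall>y\<in>UNIV. \<P>(\<omega> in P. \<forall>n\<in>{n\<^sub>0..N}. U n \<omega> = x n) > 0 \<longrightarrow>
           \<P>(\<omega> in P. U (Suc N) \<omega> = y \<bar> \<forall>n\<in>{n\<^sub>0..N}. U n \<omega> = x n) = pmf (K (x N)) y)"
      proof (intro exI[of _ K] conjI ballI allI impI)
        fix N x y assume N: "N \<ge> n\<^sub>0" and pos: "\<P>(\<omega> in P. \<forall>n\<in>{n\<^sub>0..N}. U n \<omega> = x n) > 0"
        let ?p = "\<P>(\<omega> in P. \<forall>n\<in>{n\<^sub>0..N}. U n \<omega> = x n)"
        note [measurable] = U
        \<comment> \<open>Summing over the next state reproduces the probability of the history; as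
          this is positive, it cancels and the row \<open>q (x N)\<close> has mass one.\<close>
        have "ennreal ?p = (\<integral>\<^sup>+y. emeasure P {\<omega> \<in> space P. (\<forall>n\<in>{n\<^sub>0..N}. U n \<omega> = x n) \<and> U (Suc N) \<omega> = y}
          \<partial>count_space UNIV)"
        proof (subst emeasure_eq_measure[symmetric], rule emeasure_split)
          have [measurable]: "U (Suc N) \<in> measurable P (count_space UNIV)" using N U by simp
          have [measurable]: "U n \<in> measurable P (count_space UNIV)" if "n \<in> {n\<^sub>0..N}" for n
            using that U by simp
          show "{\<omega> \<in> space P. (\<forall>n\<in>{n\<^sub>0..N}. U n \<omega> = x n) \<and> U (Suc N) \<omega> = y} \<in> sets P" for y
            by measurable
        qed auto
        also have "\<dots> = ennreal ?p * (\<integral>\<^sup>+y. q (x N) y \<partial>count_space UNIV)"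
          unfolding trans'[OF N] unfolding emeasure_eq_measure by (simp add: nn_integral_cmult)
        finally have "ennreal ?p * (\<integral>\<^sup>+y. q (x N) y \<partial>count_space UNIV) = ennreal ?p * 1"
          by simp
        then have "(\<integral>\<^sup>+y. q (x N) y \<partial>count_space UNIV) = 1"
          using pos by (subst (asm) ennreal_mult_cancel_left) auto
        from someI_ex[OF ex_pmf_ennreal[OF this]] have K: "ennreal (pmf (K (x N)) y) = q (x N) y"
          by (simp add: K_def)
        have "\<P>(\<omega> in P. (\<forall>n\<in>{n\<^sub>0..N}. U n \<omega> = x n) \<and> U (Suc N) \<omega> = y) = ?p * pmf (K (x N)) y"
          using trans'[OF N, of x y]
          by (simp add: emeasure_eq_measure K[symmetric] ennreal_mult[symmetric])
        then show "\<P>(\<omega> in P. U (Suc N) \<omega> = y \<bar> \<forall>n\<in>{n\<^sub>0..N}. U n \<omega> = x n) = pmf (K (x N)) y"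
          using pos by (simp add: cond_prob_def conj_commute)
      qed simp
    qed (use U in auto)
  qed (use P V in auto)
qed

section \<open>Hidden chains adapted to a filtration\<close>

text \<open>A hidden Markov model in one-step form: \<open>F\<close> is a filtration to which both processes are
  adapted, and given \<open>F t\<close> the next state and observation depend only on the current state.\<close>

locale hidden_chain = prob_space P
  for P :: "'w measure" +
  fixes F :: "nat \<Rightarrow> 'w measure" and X :: "nat \<Rightarrow> 'w \<Rightarrow> 'x::countable"
    and W :: "nat \<Rightarrow> 'w \<Rightarrow> 'r::polish_space"
    and K :: "'x \<Rightarrow> 'x \<Rightarrow> ennreal" and f :: "'x \<Rightarrow> 'r measure"
  assumes space_F: "space (F t) = space P"
    and sets_F: "sets (F t) \<subseteq> sets P"
    and sets_F_Suc: "sets (F t) \<subseteq> sets (F (Suc t))"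
    and X_F: "X t \<in> measurable (F t) (count_space UNIV)"
    and W_F: "W t \<in> borel_measurable (F t)"
    and prob_f: "prob_space (f a)"
    and sets_f: "sets (f a) = sets borel"
    and step: "Measurable.pred (F t) Q \<Longrightarrow> B \<in> sets borel \<Longrightarrow>
      emeasure P {\<omega> \<in> space P. Q \<omega> \<and> X t \<omega> = a \<and> X (Suc t) \<omega> = b \<and> W (Suc t) \<omega> \<in> B} =
      emeasure P {\<omega> \<in> space P. Q \<omega> \<and> X t \<omega> = a} * K a b * emeasure (f b) B"
begin

lemma sets_F_mono: "s \<le> t \<Longrightarrow> sets (F s) \<subseteq> sets (F t)"
  by (rule lift_Suc_mono_le[of "\<lambda>t. sets (F t)"]) (rule sets_F_Suc)

lemma measurable_F_mono:
  assumes "g \<in> measurable (F s) N" "s \<le> t"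
  shows "g \<in> measurable (F t) N"
  using measurable_mono[OF order_refl refl sets_F_mono[OF assms(2)]] assms(1) by (auto simp: space_F)

lemma measurable_F:
  assumes "g \<in> measurable (F s) N"
  shows "g \<in> measurable P N"
  using measurable_mono[OF order_refl refl sets_F] assms by (auto simp: space_F)

lemma X_P [measurable]: "X t \<in> measurable P (count_space UNIV)"
  by (rule measurable_F[OF X_F])

lemma W_P [measurable]: "W t \<in> borel_measurable P"
  by (rule measurable_F[OF W_F])

lemma emeasure_f_UNIV: "emeasure (f a) UNIV = 1"
  using prob_space.emeasure_space_1[OF prob_f] sets_eq_imp_space_eq[OF sets_f] by (metis space_borel)

lemma step_state:
  assumes "Measurable.pred (F t) Q"
  shows "emeasure P {\<omega> \<in> space P. Q \<omega> \<and> X t \<omega> = a \<and> X (Suc t) \<omega> = b} =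
    emeasure P {\<omega> \<in> space P. Q \<omega> \<and> X t \<omega> = a} * K a b"
  using step[OF assms, of UNIV a b] by (simp add: emeasure_f_UNIV)

text \<open>Summing \<open>step\<close> over the current state \<open>a\<close> removes it from the
  condition: given the next state, the next observation no longer depends on the past.\<close>

lemma readout:
  assumes Q: "Measurable.pred (F t) Q" and B: "B \<in> sets borel"
  shows "emeasure P {\<omega> \<in> space P. Q \<omega> \<and> X (Suc t) \<omega> = b \<and> W (Suc t) \<omega> \<in> B} =
    emeasure P {\<omega> \<in> space P. Q \<omega> \<and> X (Suc t) \<omega> = b} * emeasure (f b) B"
proof -
  note [measurable] = measurable_F[OF Q] B
  have "emeasure P {\<omega> \<in> space P. Q \<omega> \<and> X (Suc t) \<omega> = b \<and> W (Suc t) \<omega> \<in> B} =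
    (\<integral>\<^sup>+a. emeasure P {\<omega> \<in> space P. Q \<omega> \<and> X t \<omega> = a \<and> X (Suc t) \<omega> = b \<and> W (Suc t) \<omega> \<in> B} \<partial>count_space UNIV)"
    by (rule emeasure_split) auto
  also have "\<dots> = (\<integral>\<^sup>+a. emeasure P {\<omega> \<in> space P. Q \<omega> \<and> X t \<omega> = a \<and> X (Suc t) \<omega> = b} \<partial>count_space UNIV) *
      emeasure (f b) B"
    unfolding step[OF Q B] step_state[OF Q] by (simp add: nn_integral_multc)
  also have "(\<integral>\<^sup>+a. emeasure P {\<omega> \<in> space P. Q \<omega> \<and> X t \<omega> = a \<and> X (Suc t) \<omega> = b} \<partial>count_space UNIV) =
      emeasure P {\<omega> \<in> space P. Q \<omega> \<and> X (Suc t) \<omega> = b}"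
    by (rule emeasure_split[symmetric]) auto
  finally show ?thesis .
qed

section \<open>Recurrence of transitions along the path\<close>

lemma AE_transition_pos: "AE \<omega> in P. \<forall>t. K (X t \<omega>) (X (Suc t) \<omega>) > 0"
proof -
  have "AE \<omega> in P. \<forall>a b. X t \<omega> = a \<and> X (Suc t) \<omega> = b \<longrightarrow> K a b > 0" for t
    unfolding AE_all_countable
  proof (intro allI)
    fix a b
    show "AE \<omega> in P. X t \<omega> = a \<and> X (Suc t) \<omega> = b \<longrightarrow> K a b > 0"
    proof (cases "K a b = 0")
      case True
      then have "emeasure P {\<omega> \<in> space P. X t \<omega> = a \<and> X (Suc t) \<omega> = b} = 0"
        using step_state[where Q="\<lambda>_. True" and t=t and a=a and b=b] by simp
      then show ?thesis
        by (subst AE_iff_measurable[OF _ refl]) (auto simp: True)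
    qed (auto simp: zero_less_iff_neq_zero)
  qed
  then show ?thesis by (simp add: AE_all_countable)
qed

text \<open>The trials of the conditional Borel-Cantelli lemma are the visits to \<open>a\<close>;
  success means moving to \<open>b\<close> and observing a value in \<open>B\<close>.\<close>

lemma AE_infinitely_often_step:
  assumes "K a b * emeasure (f b) B > 0" "B \<in> sets borel"
  shows "AE \<omega> in P. infinite {t. X t \<omega> = a} \<longrightarrow>
    infinite {t. X t \<omega> = a \<and> X (Suc t) \<omega> = b \<and> W (Suc t) \<omega> \<in> B}"
proof (rule AE_infinitely_often_transfer[OF space_F sets_F sets_F_mono _ _ assms(1)])
  note [measurable] = X_F W_F assms(2)
  show "Measurable.pred (F t) (\<lambda>\<omega>. X t \<omega> = a)" for t by measurable
  show "Measurable.pred (F (Suc t)) (\<lambda>\<omega>. X (Suc t) \<omega> = b \<and> W (Suc t) \<omega> \<in> B)" for t by measurable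
  show "emeasure P {\<omega> \<in> space P. Q \<omega> \<and> X t \<omega> = a \<and> X (Suc t) \<omega> = b \<and> W (Suc t) \<omega> \<in> B} =
      emeasure P {\<omega> \<in> space P. Q \<omega> \<and> X t \<omega> = a} * (K a b * emeasure (f b) B)"
    if "Measurable.pred (F t) Q" for t Q
    using step[OF that assms(2)] by (simp add: mult.assoc)
qed

lemma AE_infinitely_often_pair:
  "AE \<omega> in P. \<forall>a b. K a b > 0 \<longrightarrow> infinite {t. X t \<omega> = a} \<longrightarrow>
    infinite {t. X t \<omega> = a \<and> X (Suc t) \<omega> = b}"
  unfolding AE_all_countable
proof (intro allI)
  fix a b
  show "AE \<omega> in P. K a b > 0 \<longrightarrow> infinite {t. X t \<omega> = a} \<longrightarrow> infinite {t. X t \<omega> = a \<and> X (Suc t) \<omega> = b}"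
    using AE_infinitely_often_step[of a b UNIV] emeasure_f_UNIV by (cases "K a b > 0") auto
qed

text \<open>Induction along the path: the transition from \<open>X s\<close> to
  \<open>X (Suc s)\<close> was made, hence almost surely has positive probability, and since
  \<open>X s\<close> recurs it is made infinitely often. This carries recurrence from the initial
  state, where it is assumed, to every state visited later.\<close>

lemma AE_recurrent_propagate:
  assumes "AE \<omega> in P. infinite {t. X t \<omega> = X 0 \<omega>}"
  shows "AE \<omega> in P. \<forall>s. infinite {t. X t \<omega> = X s \<omega>}"
  using assms AE_transition_pos AE_infinitely_often_pair
proof eventually_elim
  case (elim \<omega>)
  show ?case
  proof
    fix s show "infinite {t. X t \<omega> = X s \<omega>}"
    proof (induction s)
      case (Suc s)
      then have "infinite {t. X t \<omega> = X s \<omega> \<and> X (Suc t) \<omega> = X (Suc s) \<omega>}"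
        using elim(2,3) by blast
      moreover have "Suc ` {t. X t \<omega> = X s \<omega> \<and> X (Suc t) \<omega> = X (Suc s) \<omega>} \<subseteq> {t. X t \<omega> = X (Suc s) \<omega>}"
        by auto
      ultimately show ?case
        by (meson finite_imageD finite_subset inj_Suc inj_on_subset subset_UNIV)
    qed (rule elim(1))
  qed
qed

end

section \<open>The chain observed after its visits to a set\<close>

locale hidden_chain_visits = hidden_chain P F X W K f
  for P :: "'w measure" and F and X :: "nat \<Rightarrow> 'w \<Rightarrow> 'x::countable"
    and W :: "nat \<Rightarrow> 'w \<Rightarrow> 'r::polish_space" and K f +
  fixes D :: "'x set"
begin

definition visit :: "nat \<Rightarrow> nat \<Rightarrow> 'w \<Rightarrow> bool" where
  "visit n t \<omega> \<longleftrightarrow> is_visit {s. X s \<omega> \<in> D} n t"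

text \<open>The value \<open>None\<close> is the absorbing state, entered once the visits to
  \<open>D\<close> have run out.\<close>

definition U :: "nat \<Rightarrow> 'w \<Rightarrow> 'x option" where
  "U n \<omega> = after_visit {s. X s \<omega> \<in> D} (\<lambda>t. X t \<omega>) n"

definition V :: "nat \<Rightarrow> 'w \<Rightarrow> 'r option" where
  "V n \<omega> = after_visit {s. X s \<omega> \<in> D} (\<lambda>t. W t \<omega>) n"

lemma U_visit: "visit n t \<omega> \<Longrightarrow> U (Suc n) \<omega> = Some (X (Suc t) \<omega>)"
  and V_visit: "visit n t \<omega> \<Longrightarrow> V (Suc n) \<omega> = Some (W (Suc t) \<omega>)"
  by (simp_all add: visit_def U_def V_def after_visit_Suc)

lemma U_None_iff: "U (Suc n) \<omega> = None \<longleftrightarrow> (\<nexists>t. visit n t \<omega>)"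
  and V_None_iff: "V (Suc n) \<omega> = None \<longleftrightarrow> (\<nexists>t. visit n t \<omega>)"
  by (simp_all add: visit_def U_def V_def after_visit_Suc_None)

lemma U_V_Some_iff:
  "U (Suc n) \<omega> = Some a \<and> V (Suc n) \<omega> \<in> A \<longleftrightarrow>
    (\<exists>t. visit n t \<omega> \<and> X (Suc t) \<omega> = a \<and> W (Suc t) \<omega> \<in> Some -` A)"
  using U_visit[of n _ \<omega>] V_visit[of n _ \<omega>] U_None_iff[of n \<omega>] by fastforce

lemma visit_unique: "visit n s \<omega> \<Longrightarrow> visit n t \<omega> \<Longrightarrow> s = t"
  unfolding visit_def by (rule is_visit_unique)

text \<open>The visit times are stopping times: only the states up to time \<open>t\<close> are
  consulted.\<close>

lemma visit_F: "Measurable.pred (F t) (visit n t)"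
  unfolding visit_def[abs_def]
proof (rule pred_is_visit)
  show "Measurable.pred (F t) (\<lambda>\<omega>. s \<in> {s. X s \<omega> \<in> D})" if "s \<le> t" for s
    unfolding mem_Collect_eq by (rule measurable_compose[OF measurable_F_mono[OF X_F that]]) simp
qed

lemma visit_P [measurable]: "Measurable.pred P (visit n t)"
  by (rule measurable_F[OF visit_F])

text \<open>The events of the \<open>\<sigma>\<close>-algebra of the stopping time of the visit number \<open>n\<close>.\<close>

definition before :: "nat \<Rightarrow> ('w \<Rightarrow> bool) \<Rightarrow> bool" where
  "before n Q \<longleftrightarrow> Measurable.pred P Q \<and> (\<forall>t. Measurable.pred (F t) (\<lambda>\<omega>. visit n t \<omega> \<and> Q \<omega>))"

lemma before_True: "before n (\<lambda>_. True)"
  using visit_F by (simp add: before_def)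

lemma U_P: "U (Suc n) \<in> measurable P (count_space UNIV)"
  unfolding U_def[abs_def] by (rule measurable_after_visit[where N="count_space UNIV"]) auto

lemma V_P: "V (Suc n) \<in> borel_measurable P"
  unfolding V_def[abs_def]
  by (rule measurable_after_visit[where N=borel]) (auto simp: sets_borel_option_iff[symmetric])

text \<open>When visit number \<open>n\<close> happens at \<open>t\<close>, the values
  \<open>U (Suc n)\<close> and \<open>V (Suc n)\<close> are just \<open>X (Suc t)\<close> and
  \<open>W (Suc t)\<close>, which are known at \<open>Suc t\<close>.\<close>

lemma before_at_visit:
  assumes Q: "before n Q" and A: "A \<in> sets borel"
  shows "Measurable.pred (F (Suc t)) (\<lambda>\<omega>. visit n t \<omega> \<and> Q \<omega> \<and> U (Suc n) \<omega> = u \<and> V (Suc n) \<omega> \<in> A)"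
proof -
  have [measurable]: "Some -` A \<in> sets borel" using A by (simp add: sets_borel_option_iff[symmetric])
  have [measurable]: "Measurable.pred (F (Suc t)) (\<lambda>\<omega>. visit n t \<omega> \<and> Q \<omega>)"
    using Q by (intro measurable_F_mono[of _ t _ "Suc t"]) (auto simp: before_def)
  note [measurable] = X_F W_F
  have "Measurable.pred (F (Suc t)) (\<lambda>\<omega>. (visit n t \<omega> \<and> Q \<omega>) \<and> Some (X (Suc t) \<omega>) = u \<and> W (Suc t) \<omega> \<in> Some -` A)"
    by measurable
  also have "(\<lambda>\<omega>. (visit n t \<omega> \<and> Q \<omega>) \<and> Some (X (Suc t) \<omega>) = u \<and> W (Suc t) \<omega> \<in> Some -` A) =
      (\<lambda>\<omega>. visit n t \<omega> \<and> Q \<omega> \<and> U (Suc n) \<omega> = u \<and> V (Suc n) \<omega> \<in> A)"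
    by (auto simp: fun_eq_iff U_visit V_visit)
  finally show ?thesis .
qed

text \<open>Visit number \<open>Suc n\<close> at time \<open>t\<close> forces visit number
  \<open>n\<close> at some \<open>s < t\<close>, so the event is a finite union over
  \<open>s\<close> of events known at \<open>Suc s\<close>, hence at \<open>t\<close>.\<close>

lemma before_Suc:
  assumes Q: "before n Q" and A: "A \<in> sets borel"
  shows "before (Suc n) (\<lambda>\<omega>. Q \<omega> \<and> U (Suc n) \<omega> = u \<and> V (Suc n) \<omega> \<in> A)"
  unfolding before_def
proof (intro conjI allI)
  note [measurable] = U_P V_P A
  have [measurable]: "Measurable.pred P Q" using Q by (simp add: before_def)
  show "Measurable.pred P (\<lambda>\<omega>. Q \<omega> \<and> U (Suc n) \<omega> = u \<and> V (Suc n) \<omega> \<in> A)"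
    by measurable
  fix t
  note [measurable] = visit_F
  have [measurable]: "Measurable.pred (F t) (\<lambda>\<omega>. visit n s \<omega> \<and> Q \<omega> \<and> U (Suc n) \<omega> = u \<and> V (Suc n) \<omega> \<in> A)"
    if "s \<in> {..<t}" for s
    using that by (intro measurable_F_mono[OF before_at_visit[OF Q A]]) auto
  have "Measurable.pred (F t) (\<lambda>\<omega>. visit (Suc n) t \<omega> \<and>
      (\<exists>s\<in>{..<t}. visit n s \<omega> \<and> Q \<omega> \<and> U (Suc n) \<omega> = u \<and> V (Suc n) \<omega> \<in> A))"
    by measurable
  also have "(\<lambda>\<omega>. visit (Suc n) t \<omega> \<and>
      (\<exists>s\<in>{..<t}. visit n s \<omega> \<and> Q \<omega> \<and> U (Suc n) \<omega> = u \<and> V (Suc n) \<omega> \<in> A)) =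
    (\<lambda>\<omega>. visit (Suc n) t \<omega> \<and> Q \<omega> \<and> U (Suc n) \<omega> = u \<and> V (Suc n) \<omega> \<in> A)"
    using is_visit_earlier[OF _ lessI] by (force simp: fun_eq_iff visit_def)
  finally show "Measurable.pred (F t) (\<lambda>\<omega>. visit (Suc n) t \<omega> \<and> Q \<omega> \<and> U (Suc n) \<omega> = u \<and> V (Suc n) \<omega> \<in> A)" .
qed

text \<open>Since visits count from 0, the entry with index \<open>i\<close> belongs to visit number
  \<open>i - 1\<close>; the entries up to index \<open>n\<close> are therefore known at visit number
  \<open>n\<close>.\<close>

lemma before_history:
  assumes "\<And>n. A n \<in> sets borel"
  shows "before n (\<lambda>\<omega>. \<forall>i\<in>{1..n}. U i \<omega> = x i \<and> V i \<omega> \<in> A i)"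
proof (induction n)
  case (Suc n)
  have "(\<forall>i\<in>{1..Suc n}. U i \<omega> = x i \<and> V i \<omega> \<in> A i) \<longleftrightarrow>
    (\<forall>i\<in>{1..n}. U i \<omega> = x i \<and> V i \<omega> \<in> A i) \<and> U (Suc n) \<omega> = x (Suc n) \<and> V (Suc n) \<omega> \<in> A (Suc n)" for \<omega>
    by (auto simp: atLeastAtMostSuc_conv)
  then show ?case
    using before_Suc[OF Suc assms] by simp
qed (simp add: before_True)

section \<open>Read-out distributions after a visit\<close>

definition visit_readout :: "'x option \<Rightarrow> 'r option measure" where
  "visit_readout u = (case u of None \<Rightarrow> return borel None | Some a \<Rightarrow> distr (f a) borel Some)"

lemma Some_f: "Some \<in> borel_measurable (f a)"
  using sets_f[of a] sets_borel_option_iff[where 'a='r]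
  by (intro measurableI) (auto simp: sets_eq_imp_space_eq[OF sets_f])

lemma prob_visit_readout: "prob_space (visit_readout u)"
  using prob_space.prob_space_distr[OF prob_f Some_f]
  by (auto simp: visit_readout_def intro!: prob_space_return split: option.split)

lemma sets_visit_readout: "sets (visit_readout u) = sets borel"
  by (simp add: visit_readout_def split: option.split)

lemma emeasure_visit_readout_Some: "A \<in> sets borel \<Longrightarrow> emeasure (visit_readout (Some a)) A = emeasure (f a) (Some -` A)"
  using sets_eq_imp_space_eq[OF sets_f] by (simp add: visit_readout_def emeasure_distr[OF Some_f])

text \<open>For \<open>Some a\<close> the event is split by the time \<open>t\<close> of visit
  number \<open>n\<close>. Together with \<open>Q\<close> this visit is an event of
  \<open>F t\<close>, so \<open>readout\<close> applies to each piece with the same factor. For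
  \<open>None\<close> the two sequences take the value \<open>None\<close> on the same
  event.\<close>

lemma readout_visit:
  assumes Q: "before n Q" and A: "A \<in> sets borel"
  shows "emeasure P {\<omega> \<in> space P. Q \<omega> \<and> U (Suc n) \<omega> = u \<and> V (Suc n) \<omega> \<in> A} =
    emeasure P {\<omega> \<in> space P. Q \<omega> \<and> U (Suc n) \<omega> = u} * emeasure (visit_readout u) A"
proof (cases u)
  case None
  have "{\<omega> \<in> space P. Q \<omega> \<and> U (Suc n) \<omega> = u \<and> V (Suc n) \<omega> \<in> A} =
    (if None \<in> A then {\<omega> \<in> space P. Q \<omega> \<and> U (Suc n) \<omega> = u} else {})"
    using None U_None_iff[of n] V_None_iff[of n] by auto metis+
  moreover have "emeasure (visit_readout u) A = indicator A None"
    using None A by (simp add: visit_readout_def)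
  ultimately show ?thesis by simp
next
  case (Some a)
  have Q': "Measurable.pred (F t) (\<lambda>\<omega>. visit n t \<omega> \<and> Q \<omega>)" for t
    using Q by (simp add: before_def)
  have [measurable]: "Measurable.pred P Q" using Q by (simp add: before_def)
  have A': "Some -` A \<in> sets borel" using A by (simp add: sets_borel_option_iff[symmetric])
  note [measurable] = A'
  have "emeasure P {\<omega> \<in> space P. Q \<omega> \<and> U (Suc n) \<omega> = u \<and> V (Suc n) \<omega> \<in> A} =
    (\<integral>\<^sup>+t. emeasure P {\<omega> \<in> space P. (visit n t \<omega> \<and> Q \<omega>) \<and> X (Suc t) \<omega> = a \<and> W (Suc t) \<omega> \<in> Some -` A}
      \<partial>count_space UNIV)"
    unfolding Some U_V_Some_iff
    by (rule emeasure_split) (measurable, auto dest: visit_unique)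
  also have "\<dots> = (\<integral>\<^sup>+t. emeasure P {\<omega> \<in> space P. (visit n t \<omega> \<and> Q \<omega>) \<and> X (Suc t) \<omega> = a} \<partial>count_space UNIV) *
      emeasure (visit_readout u) A"
    unfolding readout[OF Q' A'] by (simp add: nn_integral_multc Some emeasure_visit_readout_Some[OF A])
  also have "(\<integral>\<^sup>+t. emeasure P {\<omega> \<in> space P. (visit n t \<omega> \<and> Q \<omega>) \<and> X (Suc t) \<omega> = a} \<partial>count_space UNIV) =
      emeasure P {\<omega> \<in> space P. Q \<omega> \<and> U (Suc n) \<omega> = u}"
    using U_V_Some_iff[of n _ a UNIV] unfolding Some
    by (intro emeasure_split[symmetric]) (auto dest: visit_unique)
  finally show ?thesis .
qed


section \<open>First entrance into \<open>D\<close> and transitions between visits\<close>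

definition hit :: "nat \<Rightarrow> nat \<Rightarrow> 'w \<Rightarrow> bool" where
  "hit t s \<omega> \<longleftrightarrow> X (t + s) \<omega> \<in> D \<and> (\<forall>r<s. X (t + r) \<omega> \<notin> D)"

lemma hit_0: "hit t 0 \<omega> \<longleftrightarrow> X t \<omega> \<in> D"
  by (simp add: hit_def)

lemma hit_Suc: "hit t (Suc s) \<omega> \<longleftrightarrow> X t \<omega> \<notin> D \<and> hit (Suc t) s \<omega>"
  by (auto simp: hit_def All_less_Suc2)

lemma hit_unique: "hit t r \<omega> \<Longrightarrow> hit t s \<omega> \<Longrightarrow> r = s"
  by (metis hit_def linorder_neqE_nat)

lemma hit_P [measurable]: "Measurable.pred P (hit t s)"
  unfolding hit_def[abs_def] by measurable

text \<open>The next visit is the first entrance into \<open>D\<close> from time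
  \<open>Suc t\<close> on; the waiting time \<open>s\<close> is 0 when two visits are
  consecutive.\<close>

lemma visit_Suc_iff:
  assumes "visit n t \<omega>"
  shows "visit (Suc n) u \<omega> \<longleftrightarrow> (\<exists>s. u = Suc t + s \<and> hit (Suc t) s \<omega>)"
proof -
  have "(\<forall>s. t < s \<and> s < u \<longrightarrow> X s \<omega> \<notin> D) \<longleftrightarrow> (\<forall>r<u - Suc t. X (Suc t + r) \<omega> \<notin> D)" if "t < u"
  proof (safe)
    fix s assume "\<forall>r<u - Suc t. X (Suc t + r) \<omega> \<notin> D" "t < s" "s < u" "X s \<omega> \<in> D"
    then show False by (metis Suc_leI diff_less_mono le_add_diff_inverse)
  qed (use that in auto)
  then show ?thesis
    using is_visit_Suc_iff[OF assms[unfolded visit_def], of u] unfolding visit_def hit_def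
    by (auto simp: less_iff_Suc_add)
qed

text \<open>The expectation of \<open>\<phi>\<close> at the first entrance to \<open>D\<close>, on the event that it happens after exactly
  \<open>s\<close> steps, for the chain started in \<open>a\<close>.\<close>

primrec hit_value :: "('x \<Rightarrow> ennreal) \<Rightarrow> nat \<Rightarrow> 'x \<Rightarrow> ennreal" where
  "hit_value \<phi> 0 a = (if a \<in> D then \<phi> a else 0)"
| "hit_value \<phi> (Suc s) a =
     (if a \<in> D then 0 else (\<integral>\<^sup>+b. K a b * hit_value \<phi> s b \<partial>count_space UNIV))"

text \<open>First-step analysis by induction on \<open>s\<close>, with \<open>t\<close>,
  \<open>Q\<close> and \<open>a\<close> free: if \<open>a\<close> is outside \<open>D\<close>, the
  chain makes one step and \<open>Q\<close> together with \<open>X t = a\<close> becomes the new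
  past. The hypothesis on \<open>\<phi>\<close> says that \<open>G t\<close> has conditional
  probability \<open>\<phi> a\<close> given any past and \<open>X t = a\<close>.\<close>

lemma emeasure_hit:
  assumes G: "\<And>t. Measurable.pred P (G t)"
    and \<phi>: "\<And>t Q a. Measurable.pred (F t) Q \<Longrightarrow>
      emeasure P {\<omega> \<in> space P. Q \<omega> \<and> X t \<omega> = a \<and> G t \<omega>} = emeasure P {\<omega> \<in> space P. Q \<omega> \<and> X t \<omega> = a} * \<phi> a"
    and Q: "Measurable.pred (F t) Q"
  shows "emeasure P {\<omega> \<in> space P. Q \<omega> \<and> X t \<omega> = a \<and> hit t s \<omega> \<and> G (t + s) \<omega>} =
    emeasure P {\<omega> \<in> space P. Q \<omega> \<and> X t \<omega> = a} * hit_value \<phi> s a"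
  using Q
proof (induction s arbitrary: t Q a)
  case 0
  have "{\<omega> \<in> space P. Q \<omega> \<and> X t \<omega> = a \<and> hit t 0 \<omega> \<and> G (t + 0) \<omega>} =
    (if a \<in> D then {\<omega> \<in> space P. Q \<omega> \<and> X t \<omega> = a \<and> G t \<omega>} else {})"
    by (auto simp: hit_0)
  then show ?case
    using \<phi>[OF 0] by simp
next
  case (Suc s)
  show ?case
  proof (cases "a \<in> D")
    case True
    then have "{\<omega> \<in> space P. Q \<omega> \<and> X t \<omega> = a \<and> hit t (Suc s) \<omega> \<and> G (t + Suc s) \<omega>} = {}"
      by (auto simp: hit_Suc)
    with True show ?thesis by (simp only: hit_value.simps) simp
  next
    case False
    note [measurable] = G measurable_F[OF Suc.prems]
    have Q': "Measurable.pred (F (Suc t)) (\<lambda>\<omega>. Q \<omega> \<and> X t \<omega> = a)"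
    proof -
      note [measurable] = measurable_F_mono[OF Suc.prems le_SucI[OF order_refl]]
        measurable_F_mono[OF X_F[of t] le_SucI[OF order_refl]]
      show ?thesis by measurable
    qed
    have "emeasure P {\<omega> \<in> space P. Q \<omega> \<and> X t \<omega> = a \<and> hit t (Suc s) \<omega> \<and> G (t + Suc s) \<omega>} =
      (\<integral>\<^sup>+b. emeasure P {\<omega> \<in> space P. (Q \<omega> \<and> X t \<omega> = a) \<and> X (Suc t) \<omega> = b \<and> hit (Suc t) s \<omega> \<and>
        G (Suc t + s) \<omega>} \<partial>count_space UNIV)"
      using False by (intro emeasure_split) (auto simp: hit_Suc)
    also have "\<dots> = (\<integral>\<^sup>+b. emeasure P {\<omega> \<in> space P. Q \<omega> \<and> X t \<omega> = a} * (K a b * hit_value \<phi> s b) \<partial>count_space UNIV)"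
      unfolding Suc.IH[OF Q'] using step_state[OF Suc.prems] by (simp add: mult.assoc)
    also have "\<dots> = emeasure P {\<omega> \<in> space P. Q \<omega> \<and> X t \<omega> = a} * hit_value \<phi> (Suc s) a"
      using False by (simp add: nn_integral_cmult)
    finally show ?thesis .
  qed
qed

text \<open>The strong Markov property. The event is split by the time \<open>t\<close> of visit
  number \<open>n\<close> and then by the waiting time \<open>s\<close> from \<open>Suc t\<close>
  until the next entrance; the sum over \<open>s\<close> does not depend on \<open>t\<close> and
  factors out.\<close>

lemma emeasure_next_visit:
  assumes G: "\<And>t. Measurable.pred P (G t)"
    and \<phi>: "\<And>t Q a. Measurable.pred (F t) Q \<Longrightarrow>
      emeasure P {\<omega> \<in> space P. Q \<omega> \<and> X t \<omega> = a \<and> G t \<omega>} = emeasure P {\<omega> \<in> space P. Q \<omega> \<and> X t \<omega> = a} * \<phi> a"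
    and Q: "before n Q" and A: "A \<in> sets borel"
  shows "emeasure P {\<omega> \<in> space P. (Q \<omega> \<and> U (Suc n) \<omega> = Some a \<and> V (Suc n) \<omega> \<in> A) \<and>
      (\<exists>t. visit (Suc n) t \<omega> \<and> G t \<omega>)} =
    emeasure P {\<omega> \<in> space P. Q \<omega> \<and> U (Suc n) \<omega> = Some a \<and> V (Suc n) \<omega> \<in> A} *
      (\<integral>\<^sup>+s. hit_value \<phi> s a \<partial>count_space UNIV)"
proof -
  define R where "R t \<omega> \<longleftrightarrow> visit n t \<omega> \<and> Q \<omega> \<and> U (Suc n) \<omega> = Some a \<and> V (Suc n) \<omega> \<in> A" for t \<omega>
  have R: "Measurable.pred (F (Suc t)) (R t)" for t
    unfolding R_def[abs_def] by (rule before_at_visit[OF Q A])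
  note [measurable] = G measurable_F[OF R]
  have XR: "X (Suc t) \<omega> = a" if "R t \<omega>" for t \<omega>
    using that U_visit[of n t \<omega>] by (simp add: R_def)
  have ex: "(Q \<omega> \<and> U (Suc n) \<omega> = Some a \<and> V (Suc n) \<omega> \<in> A) \<longleftrightarrow> (\<exists>t. R t \<omega>)" for \<omega>
    using U_None_iff[of n \<omega>] by (auto simp: R_def)
  have uniq: "s = t" if "R s \<omega>" "R t \<omega>" for s t \<omega>
    using that visit_unique by (auto simp: R_def)
  have "emeasure P {\<omega> \<in> space P. (Q \<omega> \<and> U (Suc n) \<omega> = Some a \<and> V (Suc n) \<omega> \<in> A) \<and>
      (\<exists>t. visit (Suc n) t \<omega> \<and> G t \<omega>)} =
    (\<integral>\<^sup>+t. emeasure P {\<omega> \<in> space P. R t \<omega> \<and> X (Suc t) \<omega> = a \<and> (\<exists>s. hit (Suc t) s \<omega> \<and> G (Suc t + s) \<omega>)}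
      \<partial>count_space UNIV)"
  proof (rule emeasure_split)
    fix \<omega>
    have "(\<exists>u. visit (Suc n) u \<omega> \<and> G u \<omega>) \<longleftrightarrow> (\<exists>s. hit (Suc t) s \<omega> \<and> G (Suc t + s) \<omega>)" if "R t \<omega>" for t
      using that visit_Suc_iff[of n t \<omega>] by (auto simp: R_def)
    then show "(Q \<omega> \<and> U (Suc n) \<omega> = Some a \<and> V (Suc n) \<omega> \<in> A) \<and> (\<exists>t. visit (Suc n) t \<omega> \<and> G t \<omega>) \<longleftrightarrow>
      (\<exists>t. R t \<omega> \<and> X (Suc t) \<omega> = a \<and> (\<exists>s. hit (Suc t) s \<omega> \<and> G (Suc t + s) \<omega>))"
      unfolding ex using XR by blast
  qed (use uniq in auto)
  also have "\<dots> = (\<integral>\<^sup>+t. emeasure P {\<omega> \<in> space P. R t \<omega>} * (\<integral>\<^sup>+s. hit_value \<phi> s a \<partial>count_space UNIV) \<partial>count_space UNIV)"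
  proof (intro nn_integral_cong)
    fix t
    have "emeasure P {\<omega> \<in> space P. R t \<omega> \<and> X (Suc t) \<omega> = a \<and> (\<exists>s. hit (Suc t) s \<omega> \<and> G (Suc t + s) \<omega>)} =
      (\<integral>\<^sup>+s. emeasure P {\<omega> \<in> space P. R t \<omega> \<and> X (Suc t) \<omega> = a \<and> hit (Suc t) s \<omega> \<and> G (Suc t + s) \<omega>} \<partial>count_space UNIV)"
      by (rule emeasure_split) (auto dest: hit_unique)
    also have "\<dots> = emeasure P {\<omega> \<in> space P. R t \<omega> \<and> X (Suc t) \<omega> = a} * (\<integral>\<^sup>+s. hit_value \<phi> s a \<partial>count_space UNIV)"
      by (subst nn_integral_cmult[symmetric]) (auto intro!: nn_integral_cong emeasure_hit[OF G \<phi> R] simp del: add_Suc)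
    also have "{\<omega> \<in> space P. R t \<omega> \<and> X (Suc t) \<omega> = a} = {\<omega> \<in> space P. R t \<omega>}"
      using XR by auto
    finally show "emeasure P {\<omega> \<in> space P. R t \<omega> \<and> X (Suc t) \<omega> = a \<and> (\<exists>s. hit (Suc t) s \<omega> \<and> G (Suc t + s) \<omega>)} =
      emeasure P {\<omega> \<in> space P. R t \<omega>} * (\<integral>\<^sup>+s. hit_value \<phi> s a \<partial>count_space UNIV)" .
  qed
  also have "\<dots> = (\<integral>\<^sup>+t. emeasure P {\<omega> \<in> space P. R t \<omega>} \<partial>count_space UNIV) * (\<integral>\<^sup>+s. hit_value \<phi> s a \<partial>count_space UNIV)"
    by (simp add: nn_integral_multc)
  also have "(\<integral>\<^sup>+t. emeasure P {\<omega> \<in> space P. R t \<omega>} \<partial>count_space UNIV) =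
      emeasure P {\<omega> \<in> space P. Q \<omega> \<and> U (Suc n) \<omega> = Some a \<and> V (Suc n) \<omega> \<in> A}"
    by (rule emeasure_split[symmetric]) (use uniq ex in auto)
  finally show ?thesis .
qed

text \<open>From \<open>Some a\<close> the chain runs until it first enters \<open>D\<close>, in
  some state \<open>c\<close>, and then steps from \<open>c\<close> to \<open>b\<close>. The mass of
  \<open>None\<close> is the probability of never entering \<open>D\<close>.\<close>

definition visit_kernel :: "'x option \<Rightarrow> 'x option \<Rightarrow> ennreal" where
  "visit_kernel u v = (case u of
      None \<Rightarrow> (if v = None then 1 else 0)
    | Some a \<Rightarrow> (case v of
        None \<Rightarrow> 1 - (\<integral>\<^sup>+s. hit_value (\<lambda>_. 1) s a \<partial>count_space UNIV)
      | Some b \<Rightarrow> (\<integral>\<^sup>+s. hit_value (\<lambda>c. K c b) s a \<partial>count_space UNIV)))"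

text \<open>Both nontrivial cases are instances of \<open>emeasure_next_visit\<close>: one where
  \<open>G t\<close> is the event that the step after the next visit leads to \<open>b\<close>, one
  where it is the sure event, followed by passing to the complement.\<close>

lemma transition_visit:
  assumes Q: "before n Q" and A: "A \<in> sets borel"
  shows "emeasure P {\<omega> \<in> space P. (Q \<omega> \<and> U (Suc n) \<omega> = u \<and> V (Suc n) \<omega> \<in> A) \<and> U (Suc (Suc n)) \<omega> = v} =
    emeasure P {\<omega> \<in> space P. Q \<omega> \<and> U (Suc n) \<omega> = u \<and> V (Suc n) \<omega> \<in> A} * visit_kernel u v"
proof -
  have [measurable]: "Measurable.pred P Q" using Q by (simp add: before_def)
  note [measurable] = U_P V_P A
  consider "u = None" | a b where "u = Some a" "v = Some b" | a where "u = Some a" "v = None"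
    by (cases u; cases v) auto
  then show ?thesis
  proof cases
    case 1
    have "U (Suc (Suc n)) \<omega> = None" if "U (Suc n) \<omega> = None" for \<omega>
      using that is_visit_earlier[OF _ lessI] unfolding U_None_iff visit_def by blast
    then have "{\<omega> \<in> space P. (Q \<omega> \<and> U (Suc n) \<omega> = u \<and> V (Suc n) \<omega> \<in> A) \<and> U (Suc (Suc n)) \<omega> = v} =
      (if v = None then {\<omega> \<in> space P. Q \<omega> \<and> U (Suc n) \<omega> = u \<and> V (Suc n) \<omega> \<in> A} else {})"
      using 1 by auto
    then show ?thesis
      using 1 by (simp add: visit_kernel_def)
  next
    case (2 a b)
    have "U (Suc (Suc n)) \<omega> = Some b \<longleftrightarrow> (\<exists>t. visit (Suc n) t \<omega> \<and> X (Suc t) \<omega> = b)" for \<omega>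
      by (simp add: U_def visit_def after_visit_Suc_Some)
    moreover have "Measurable.pred P (\<lambda>\<omega>. X (Suc t) \<omega> = b)" for t
      by measurable
    \<comment> \<open>Here \<open>step_state\<close> is the hypothesis on \<open>\<phi>\<close>,
      with \<open>\<phi> c = K c b\<close>.\<close>
    note emeasure_next_visit[OF this step_state Q A, of a]
    ultimately show ?thesis
      using 2 by (simp add: visit_kernel_def)
  next
    case (3 a)
    let ?H = "{\<omega> \<in> space P. Q \<omega> \<and> U (Suc n) \<omega> = u \<and> V (Suc n) \<omega> \<in> A}"
    let ?S = "{\<omega> \<in> space P. (Q \<omega> \<and> U (Suc n) \<omega> = u \<and> V (Suc n) \<omega> \<in> A) \<and> (\<exists>t. visit (Suc n) t \<omega>)}"
    have "{\<omega> \<in> space P. (Q \<omega> \<and> U (Suc n) \<omega> = u \<and> V (Suc n) \<omega> \<in> A) \<and> U (Suc (Suc n)) \<omega> = v} = ?H - ?S"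
      using 3 by (auto simp: U_None_iff)
    moreover have "emeasure P (?H - ?S) = emeasure P ?H - emeasure P ?S"
      by (rule emeasure_Diff) (auto simp: emeasure_eq_measure)
    moreover have "emeasure P ?S = emeasure P ?H * (\<integral>\<^sup>+s. hit_value (\<lambda>_. 1) s a \<partial>count_space UNIV)"
      using emeasure_next_visit[where G="\<lambda>_ _. True" and \<phi>="\<lambda>_. 1", OF _ _ Q A, of a] 3 by simp
    ultimately show ?thesis
      using 3 by (simp add: visit_kernel_def ennreal_right_diff_distrib emeasure_eq_measure)
  qed
qed

lemma hmm_pair_visits: "hmm_pair P 1 UNIV U V"
proof (rule hmm_pairI[where g=visit_readout and q=visit_kernel])
  show "prob_space P" by (rule prob_space_axioms)
  show "U n \<in> measurable P (count_space UNIV)" if "n \<ge> 1" for n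
    using U_P[of "n - 1"] that by simp
  show "V n \<in> borel_measurable P" if "n \<ge> 1" for n
    using V_P[of "n - 1"] that by simp
  show "emeasure P {\<omega> \<in> space P. (\<forall>n\<in>{1..N}. U n \<omega> = x n \<and> V n \<omega> \<in> A n) \<and> U (Suc N) \<omega> = y} =
      emeasure P {\<omega> \<in> space P. \<forall>n\<in>{1..N}. U n \<omega> = x n \<and> V n \<omega> \<in> A n} * visit_kernel (x N) y"
    if "1 \<le> N" and A: "\<And>n. A n \<in> sets borel" for N x A y
  proof -
    obtain m where m: "N = Suc m" using \<open>1 \<le> N\<close> by (cases N) auto
    have "(\<forall>n\<in>{1..N}. U n \<omega> = x n \<and> V n \<omega> \<in> A n) \<longleftrightarrow>
      (\<forall>n\<in>{1..m}. U n \<omega> = x n \<and> V n \<omega> \<in> A n) \<and> U (Suc m) \<omega> = x N \<and> V (Suc m) \<omega> \<in> A N" for \<omega>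
      by (auto simp: m atLeastAtMostSuc_conv)
    then show ?thesis
      using transition_visit[OF before_history[of A m x] A[of N], of "x N" y] A by (simp add: m)
  qed
  show "emeasure P {\<omega> \<in> space P. (\<forall>n\<in>{1..<N}. U n \<omega> = x n \<and> V n \<omega> \<in> A n) \<and> U N \<omega> = y \<and> V N \<omega> \<in> B} =
      emeasure P {\<omega> \<in> space P. (\<forall>n\<in>{1..<N}. U n \<omega> = x n \<and> V n \<omega> \<in> A n) \<and> U N \<omega> = y} * emeasure (visit_readout y) B"
    if "1 \<le> N" and A: "\<And>n. A n \<in> sets borel" and B: "B \<in> sets borel" for N x A y B
  proof -
    obtain m where m: "N = Suc m" using \<open>1 \<le> N\<close> by (cases N) auto
    then have "{1..<N} = {1..m}" by auto
    then show ?thesis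
      using readout_visit[OF before_history[of A m x] B, of y] A by (simp add: m)
  qed
  show "emeasure P {\<omega> \<in> space P. U N \<omega> = y \<and> V N \<omega> \<in> B} =
      emeasure P {\<omega> \<in> space P. U N \<omega> = y} * emeasure (visit_readout y) B"
    if "1 \<le> N" and B: "B \<in> sets borel" for N y B
    using readout_visit[OF before_True B, of "N - 1" y] that(1) by simp
qed (rule prob_visit_readout sets_visit_readout)+

text \<open>If \<open>U 1\<close> is \<open>None\<close>, no visit ever takes place and
  \<open>U\<close> stays there. Otherwise the state at the first visit recurs, hence so does the
  transition made from it; every repetition starts in \<open>D\<close> and gives a further index at
  which \<open>U\<close> equals \<open>U 1\<close>.\<close>

lemma recurrent_visits:
  assumes "AE \<omega> in P. \<forall>s. infinite {t. X t \<omega> = X s \<omega>}"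
  shows "recurrent_chain P 1 UNIV U"
  unfolding recurrent_chain_def
proof (intro ballI impI)
  fix u assume pos: "\<P>(\<omega> in P. U 1 \<omega> = u) > 0"
  have [measurable]: "U n \<in> measurable P (count_space UNIV)" if "n \<ge> 1" for n
    using U_P[of "n - 1"] that by simp
  have "AE \<omega> in P. U 1 \<omega> = u \<longrightarrow> infinite {n. n \<ge> 1 \<and> U n \<omega> = u}"
    using assms AE_transition_pos AE_infinitely_often_pair
  proof eventually_elim
    case (elim \<omega>)
    show ?case
    proof
      assume u: "U 1 \<omega> = u"
      show "infinite {n. n \<ge> 1 \<and> U n \<omega> = u}"
      proof (cases u)
        case None
        have "U n \<omega> = u" if "n \<ge> 1" for n
        proof (cases "n = 1")
          case False
          with that obtain m where m: "n = Suc m" "0 < m" by (cases n) auto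
          show ?thesis
            using None u is_visit_earlier[OF _ m(2)] U_None_iff[of 0 \<omega>] U_None_iff[of m \<omega>]
            unfolding visit_def m by (metis One_nat_def)
        qed (use u in simp)
        then have "{n. n \<ge> 1 \<and> U n \<omega> = u} = {1..}" by auto
        then show ?thesis by (simp add: infinite_Ici)
      next
        case (Some a)
        then obtain t where t: "visit 0 t \<omega>" "X (Suc t) \<omega> = a"
          using u by (auto simp: U_def visit_def after_visit_Suc_Some)
        have "infinite {s. X s \<omega> = X t \<omega> \<and> X (Suc s) \<omega> = a}"
          using elim t(2) by blast
        moreover have "X t \<omega> \<in> D" using t(1) by (simp add: visit_def is_visit_def)
        ultimately have "infinite {s \<in> {s. X s \<omega> \<in> D}. X (Suc s) \<omega> = a}"
          by (elim infinite_super[rotated]) auto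
        then show ?thesis
          unfolding U_def Some by (rule infinite_after_visit)
      qed
    qed
  qed
  moreover have [measurable]: "Measurable.pred P (\<lambda>\<omega>. infinite {n. n \<ge> 1 \<and> U n \<omega> = u})"
    unfolding infinite_nat_iff_unbounded_le mem_Collect_eq by measurable
  ultimately have "\<P>(\<omega> in P. infinite {n. n \<ge> 1 \<and> U n \<omega> = u} \<and> U 1 \<omega> = u) = \<P>(\<omega> in P. U 1 \<omega> = u)"
    by (intro finite_measure_eq_AE) auto
  then show "\<P>(\<omega> in P. infinite {n. n \<ge> 1 \<and> U n \<omega> = u} \<bar> U 1 \<omega> = u) = 1"
    using pos by (simp add: cond_prob_def)
qed

end

section \<open>Flagged states\<close>

definition flag_set :: "'r set \<Rightarrow> bool \<Rightarrow> 'r set" where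
  "flag_set E c = (if c then E else - E)"

text \<open>The new flag is drawn from the read-out distribution of the new state; the old flag has
  no influence.\<close>

definition flag_kernel ::
    "('x \<Rightarrow> 'x \<Rightarrow> ennreal) \<Rightarrow> ('x \<Rightarrow> 'r measure) \<Rightarrow> 'r set \<Rightarrow> 'x \<times> bool \<Rightarrow> 'x \<times> bool \<Rightarrow> ennreal" where
  "flag_kernel K f E p q = K (fst p) (fst q) * emeasure (f (fst q)) (flag_set E (snd q))"

text \<open>If the flagged state \<open>q\<close> is never entered, its read-out distribution is irrelevant.\<close>

definition flag_readout :: "('x \<Rightarrow> 'r measure) \<Rightarrow> 'r set \<Rightarrow> 'x \<times> bool \<Rightarrow> 'r measure" where
  "flag_readout f E q =
     (if emeasure (f (fst q)) (flag_set E (snd q)) = 0 then f (fst q)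
      else uniform_measure (f (fst q)) (flag_set E (snd q)))"

lemma mem_flag_set: "w \<in> flag_set E c \<longleftrightarrow> (w \<in> E) = c"
  by (auto simp: flag_set_def)

lemma sets_borel_flag_set: "E \<in> sets borel \<Longrightarrow> flag_set E c \<in> sets borel"
  by (auto simp: flag_set_def)

text \<open>The flag is a function of \<open>W t\<close>, so the filtration can be kept. Entering
  the flagged state \<open>q\<close> and observing a value in \<open>B\<close> means entering
  \<open>fst q\<close> and observing a value in \<open>B\<close> on the side of \<open>E\<close>
  prescribed by \<open>snd q\<close>; the probability of the latter factors into that of the flag
  and the read-out conditioned on it.\<close>

lemma (in hidden_chain) hidden_chain_flag:
  assumes E: "E \<in> sets borel"
  shows "hidden_chain P F (\<lambda>t \<omega>. (X t \<omega>, W t \<omega> \<in> E)) W (flag_kernel K f E) (flag_readout f E)"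
proof (intro hidden_chain.intro hidden_chain_axioms.intro)
  have \<E>: "flag_set E c \<in> sets (f y)" for c y
    using sets_borel_flag_set[OF E] by (simp add: sets_f)
  have fin: "emeasure (f y) C \<noteq> \<infinity>" for y C
    using finite_measure.emeasure_finite[OF prob_space.finite_measure[OF prob_f]] by simp
  note [measurable] = X_F W_F E
  show "(\<lambda>\<omega>. (X t \<omega>, W t \<omega> \<in> E)) \<in> measurable (F t) (count_space UNIV)" for t
  proof -
    have "(\<lambda>\<omega>. (X t \<omega>, W t \<omega> \<in> E)) \<in> measurable (F t) (count_space UNIV \<Otimes>\<^sub>M count_space UNIV)"
      by measurable
    then show ?thesis
      by (simp add: pair_measure_countable)
  qed
  show "prob_space (flag_readout f E q)" for q
    using prob_f fin by (auto simp: flag_readout_def intro!: prob_space_uniform_measure)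
  show "sets (flag_readout f E q) = sets borel" for q
    using sets_f by (auto simp: flag_readout_def)
  fix t Q and p q :: "'x \<times> bool" and B :: "'r set" assume Q [measurable]: "Measurable.pred (F t) Q" and B: "B \<in> sets borel"
  \<comment> \<open>The flag of the current state \<open>p\<close> is moved into the past, where
    \<open>step\<close> of the original chain accepts it.\<close>
  have Q': "Measurable.pred (F t) (\<lambda>\<omega>. Q \<omega> \<and> (W t \<omega> \<in> E) = snd p)"
    by measurable
  \<comment> \<open>The multiplication rule for conditional probabilities; when the flag has
    probability zero, both sides vanish.\<close>
  have split: "emeasure (f (fst q)) (flag_set E (snd q) \<inter> B) =
    emeasure (f (fst q)) (flag_set E (snd q)) * emeasure (flag_readout f E q) B"
  proof (cases "emeasure (f (fst q)) (flag_set E (snd q)) = 0")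
    case True
    then have "emeasure (f (fst q)) (flag_set E (snd q) \<inter> B) \<le> 0"
      using \<E> by (metis emeasure_mono inf_le1)
    with True show ?thesis by simp
  next
    case False
    then show ?thesis
      using \<E> B fin
        mult_divide_eq_ennreal[of "emeasure (f (fst q)) (flag_set E (snd q))" "emeasure (f (fst q)) (flag_set E (snd q) \<inter> B)"]
      by (simp add: flag_readout_def sets_f ennreal_times_divide mult.commute[of "emeasure (f (fst q)) (flag_set E (snd q))"])
  qed
  have "emeasure P {\<omega> \<in> space P. Q \<omega> \<and> (X t \<omega>, W t \<omega> \<in> E) = p \<and> (X (Suc t) \<omega>, W (Suc t) \<omega> \<in> E) = q \<and> W (Suc t) \<omega> \<in> B} =
    emeasure P {\<omega> \<in> space P. (Q \<omega> \<and> (W t \<omega> \<in> E) = snd p) \<and> X t \<omega> = fst p \<and> X (Suc t) \<omega> = fst q \<and>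
      W (Suc t) \<omega> \<in> flag_set E (snd q) \<inter> B}"
    by (intro arg_cong[where f="emeasure P"]) (auto simp: mem_flag_set prod_eq_iff)
  also have "\<dots> = emeasure P {\<omega> \<in> space P. (Q \<omega> \<and> (W t \<omega> \<in> E) = snd p) \<and> X t \<omega> = fst p} * K (fst p) (fst q) *
      emeasure (f (fst q)) (flag_set E (snd q) \<inter> B)"
    using sets_borel_flag_set[OF E] B by (intro step[OF Q']) auto
  also have "{\<omega> \<in> space P. (Q \<omega> \<and> (W t \<omega> \<in> E) = snd p) \<and> X t \<omega> = fst p} =
      {\<omega> \<in> space P. Q \<omega> \<and> (X t \<omega>, W t \<omega> \<in> E) = p}"
    by (auto simp: prod_eq_iff)
  finally show "emeasure P {\<omega> \<in> space P. Q \<omega> \<and> (X t \<omega>, W t \<omega> \<in> E) = p \<and> (X (Suc t) \<omega>, W (Suc t) \<omega> \<in> E) = q \<and>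
      W (Suc t) \<omega> \<in> B} =
    emeasure P {\<omega> \<in> space P. Q \<omega> \<and> (X t \<omega>, W t \<omega> \<in> E) = p} * flag_kernel K f E p q * emeasure (flag_readout f E q) B"
    by (simp add: flag_kernel_def split mult.assoc)
qed (fact prob_space_axioms space_F sets_F sets_F_Suc W_F)+

text \<open>A flag at time 0 recurs: the initial state is entered again from some state that is itself
  visited infinitely often, and each such entry produces the flag with a fixed positive probability.\<close>

lemma (in hidden_chain) AE_recurrent_flag:
  assumes E: "E \<in> sets borel"
    and rec: "AE \<omega> in P. infinite {t. X t \<omega> = X 0 \<omega>}"
    and init: "\<And>x B. B \<in> sets borel \<Longrightarrow> emeasure P {\<omega> \<in> space P. X 0 \<omega> = x \<and> W 0 \<omega> \<in> B} =
      emeasure P {\<omega> \<in> space P. X 0 \<omega> = x} * emeasure (f x) B"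
  shows "AE \<omega> in P. infinite {t. (X t \<omega>, W t \<omega> \<in> E) = (X 0 \<omega>, W 0 \<omega> \<in> E)}"
proof -
  let ?E = "flag_set E"
  note E' [measurable] = sets_borel_flag_set[OF E]
  \<comment> \<open>The observation at time 0 follows no transition and is not governed by
    \<open>step\<close>; \<open>init\<close> shows that its flag almost surely has positive read-out
    probability.\<close>
  have "AE \<omega> in P. \<forall>x c. X 0 \<omega> = x \<and> W 0 \<omega> \<in> ?E c \<longrightarrow> emeasure (f x) (?E c) > 0"
    unfolding AE_all_countable
  proof (intro allI)
    fix x c
    show "AE \<omega> in P. X 0 \<omega> = x \<and> W 0 \<omega> \<in> ?E c \<longrightarrow> emeasure (f x) (?E c) > 0"
    proof (cases "emeasure (f x) (?E c) = 0")
      case True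
      then have "emeasure P {\<omega> \<in> space P. X 0 \<omega> = x \<and> W 0 \<omega> \<in> ?E c} = 0"
        using init[OF E', of x c] by simp
      then show ?thesis
        by (subst AE_iff_measurable[OF _ refl]) (auto simp: True)
    qed (auto simp: zero_less_iff_neq_zero)
  qed
  moreover have "AE \<omega> in P. \<forall>a b c. K a b * emeasure (f b) (?E c) > 0 \<longrightarrow> infinite {t. X t \<omega> = a} \<longrightarrow>
    infinite {t. X t \<omega> = a \<and> X (Suc t) \<omega> = b \<and> W (Suc t) \<omega> \<in> ?E c}"
    unfolding AE_all_countable
  proof (intro allI)
    fix a b c
    show "AE \<omega> in P. K a b * emeasure (f b) (?E c) > 0 \<longrightarrow> infinite {t. X t \<omega> = a} \<longrightarrow>
      infinite {t. X t \<omega> = a \<and> X (Suc t) \<omega> = b \<and> W (Suc t) \<omega> \<in> ?E c}"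
      using AE_infinitely_often_step[OF _ E', of a b c] by (cases "K a b * emeasure (f b) (?E c) > 0") auto
  qed
  ultimately show ?thesis
    using rec AE_recurrent_propagate[OF rec] AE_transition_pos
  proof eventually_elim
    case (elim \<omega>)
    define x c where "x = X 0 \<omega>" and "c \<longleftrightarrow> W 0 \<omega> \<in> E"
    have "emeasure (f x) (?E c) > 0"
      using elim(1) by (auto simp: x_def c_def mem_flag_set)
    \<comment> \<open>A return at a positive time has a predecessor \<open>r\<close>, and the
      transition from \<open>X r\<close> into \<open>x\<close> is the one that recurs.\<close>
    moreover obtain s where s: "s \<ge> 1" "X s \<omega> = x"
      using elim(3) unfolding infinite_nat_iff_unbounded_le x_def by blast
    then obtain r where r: "s = Suc r" by (cases s) auto
    moreover have "K (X r \<omega>) x > 0"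
      using elim(5) s r by auto
    ultimately have "K (X r \<omega>) x * emeasure (f x) (?E c) > 0"
      by (simp add: ennreal_zero_less_mult_iff)
    then have "infinite {t. X t \<omega> = X r \<omega> \<and> X (Suc t) \<omega> = x \<and> W (Suc t) \<omega> \<in> ?E c}"
      using elim(2,4) by blast
    moreover have "Suc ` {t. X t \<omega> = X r \<omega> \<and> X (Suc t) \<omega> = x \<and> W (Suc t) \<omega> \<in> ?E c} \<subseteq>
      {t. (X t \<omega>, W t \<omega> \<in> E) = (X 0 \<omega>, W 0 \<omega> \<in> E)}"
      by (auto simp: x_def c_def mem_flag_set)
    ultimately show ?case
      by (meson finite_imageD finite_subset inj_Suc inj_on_subset subset_UNIV)
  qed
qed

section \<open>Filtration of a hidden Markov model\<close>

text \<open>The conditional formulas are turned into products for cylinder events,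
  \<open>F N\<close> is generated by the cylinders up to time \<open>N\<close>, and the one-step
  identity passes from cylinders to all of \<open>F N\<close> by uniqueness of measures. The law at
  time 0 is returned separately because the one-step identity does not contain it.\<close>

lemma hidden_chain_of_hmm_pair:
  fixes X :: "nat \<Rightarrow> 'w \<Rightarrow> 'x::countable" and W :: "nat \<Rightarrow> 'w \<Rightarrow> 'r::polish_space"
  assumes pair: "hmm_pair P 0 \<X> X W"
  obtains F K f where "hidden_chain P F X W K f"
    and "\<And>x B. B \<in> sets borel \<Longrightarrow> emeasure P {\<omega> \<in> space P. X 0 \<omega> = x \<and> W 0 \<omega> \<in> B} =
      emeasure P {\<omega> \<in> space P. X 0 \<omega> = x} * emeasure (f x) B"
proof -
  interpret prob_space P using pair by (simp add: hmm_pair_def)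
  have W [measurable]: "W n \<in> borel_measurable P" for n
    using pair by (simp add: hmm_pair_def)
  have chain: "markov_chain P 0 \<X> X" using pair by (simp add: hmm_pair_def)
  have X\<X>: "X n \<in> measurable P (count_space \<X>)" for n
    using chain by (simp add: markov_chain_def)
  have X [measurable]: "X n \<in> measurable P (count_space UNIV)" for n
    by (rule measurable_compose[OF X\<X>]) simp
  have in_\<X>: "X n \<omega> \<in> \<X>" if "\<omega> \<in> space P" for n \<omega>
    using measurable_space[OF X\<X> that] by simp
  obtain K where *: "(\<forall>x\<in>\<X>. set_pmf (K x) \<subseteq> \<X>) \<and> (\<forall>N\<ge>0. \<forall>x. \<forall>y\<in>\<X>.
      \<P>(\<omega> in P. \<forall>n\<in>{0..N}. X n \<omega> = x n) > 0 \<longrightarrow>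
      \<P>(\<omega> in P. X (Suc N) \<omega> = y \<bar> \<forall>n\<in>{0..N}. X n \<omega> = x n) = pmf (K (x N)) y)"
    using chain unfolding markov_chain_def by (elim conjE exE, intro that conjI)
  note K = *[THEN conjunct1, rule_format] and KP = *[THEN conjunct2, rule_format, OF le0]
  obtain f\<^sub>0 :: "'x \<Rightarrow> 'r measure" where **: "(\<forall>x\<in>\<X>. prob_space (f\<^sub>0 x) \<and> sets (f\<^sub>0 x) = sets borel) \<and>
      (\<forall>n\<ge>0. \<forall>x\<in>\<X>. \<forall>A\<in>sets borel. \<P>(\<omega> in P. X n \<omega> = x) > 0 \<longrightarrow>
         \<P>(\<omega> in P. W n \<omega> \<in> A \<bar> X n \<omega> = x) = measure (f\<^sub>0 x) A)"
    using pair unfolding hmm_pair_def by (elim conjE exE, intro that conjI)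
  note f\<^sub>0 = **[THEN conjunct1, rule_format] **[THEN conjunct2, rule_format, OF le0]
  have prodP: "\<P>(\<omega> in P. \<forall>n\<in>{0..N}. W n \<omega> \<in> A n \<bar> \<forall>n\<in>{0..N}. X n \<omega> = x n) =
      (\<Prod>n\<in>{0..N}. \<P>(\<omega> in P. W n \<omega> \<in> A n \<bar> X n \<omega> = x n))"
    if "\<And>n. A n \<in> sets borel" "\<P>(\<omega> in P. \<forall>n\<in>{0..N}. X n \<omega> = x n) > 0" for N A x
    using pair that by (simp add: hmm_pair_def)
  \<comment> \<open>\<open>hidden_chain\<close> wants a probability measure for every state of the
    type; outside \<open>\<X>\<close> an arbitrary point mass serves.\<close>
  define f where "f x = (if x \<in> \<X> then f\<^sub>0 x else return borel undefined)" for x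
  have f: "prob_space (f x)" "sets (f x) = sets borel" for x
    using f\<^sub>0(1)[of x] by (auto simp: f_def intro!: prob_space_return)
  have fm: "emeasure (f x) A = ennreal (measure (f x) A)" for x A
    using f by (simp add: finite_measure.emeasure_eq_measure prob_space.finite_measure)

  define path where "path N x = {\<omega> \<in> space P. \<forall>n\<in>{0..N}. X n \<omega> = x n}" for N x
  define cyl where "cyl N x A = {\<omega> \<in> space P. \<forall>n\<in>{0..N}. X n \<omega> = x n \<and> W n \<omega> \<in> A n}"
    for N x and A :: "nat \<Rightarrow> 'r set"
  have [measurable]: "path N x \<in> sets P" for N x
    unfolding path_def by measurable
  have cyl_sets: "cyl N x A \<in> sets P" if "\<And>n. A n \<in> sets borel" for N x A
    using that unfolding cyl_def by measurable
  have path_in: "x n \<in> \<X>" if pos: "measure P (path N x) > 0" and n: "n \<le> N" for N n x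
  proof -
    from pos have "path N x \<noteq> {}" by auto
    then obtain \<omega> where "\<omega> \<in> space P" "X n \<omega> = x n" using n by (auto simp: path_def)
    with in_\<X>[of \<omega> n] show ?thesis by simp
  qed
  \<comment> \<open>Also valid where no conditional probability is available: a null path stays null
    when extended, and a continuation outside \<open>\<X>\<close> has probability zero on both
    sides.\<close>
  have path_Suc: "measure P (path (Suc N) x) = measure P (path N x) * pmf (K (x N)) (x (Suc N))" for N x
  proof (cases "measure P (path N x) > 0")
    case True
    have eq: "path (Suc N) x = {\<omega> \<in> space P. X (Suc N) \<omega> = x (Suc N) \<and> (\<forall>n\<in>{0..N}. X n \<omega> = x n)}"
      by (auto simp: path_def atLeast0_atMost_Suc)
    show ?thesis
    proof (cases "x (Suc N) \<in> \<X>")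
      case inX: True
      have "\<P>(\<omega> in P. X (Suc N) \<omega> = x (Suc N) \<bar> \<forall>n\<in>{0..N}. X n \<omega> = x n) = measure P (path (Suc N) x) / measure P (path N x)"
        unfolding cond_prob_def eq by (simp add: path_def)
      with KP[OF inX, of N x] True show ?thesis
        by (simp add: path_def[symmetric] field_simps)
    next
      case False
      then have "path (Suc N) x = {}" using in_\<X> by (auto simp: eq) metis
      moreover have "pmf (K (x N)) (x (Suc N)) = 0"
        using K[OF path_in[OF True order_refl]] False by (auto simp: pmf_eq_0_set_pmf)
      ultimately show ?thesis by simp
    qed
  next
    case False
    then have "measure P (path N x) = 0"
      using measure_nonneg[of P "path N x"] by linarith
    moreover have "measure P (path (Suc N) x) \<le> measure P (path N x)"
      by (rule finite_measure_mono) (auto simp: path_def)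
    ultimately show ?thesis
      using measure_nonneg[of P "path (Suc N) x"] by simp
  qed
  have cyl_eq: "measure P (cyl N x A) = measure P (path N x) * (\<Prod>n\<in>{0..N}. measure (f (x n)) (A n))"
    if A: "\<And>n. A n \<in> sets borel" for N x A
  proof (cases "measure P (path N x) > 0")
    case True
    have single: "\<P>(\<omega> in P. W n \<omega> \<in> A n \<bar> X n \<omega> = x n) = measure (f (x n)) (A n)" if "n \<in> {0..N}" for n
    proof -
      have "measure P (path N x) \<le> \<P>(\<omega> in P. X n \<omega> = x n)"
        using that by (intro finite_measure_mono) (auto simp: path_def)
      with f\<^sub>0(2)[OF path_in[OF True] A, of n n] that True path_in[OF True, of n] show ?thesis
        by (simp add: f_def)
    qed
    have "measure P (cyl N x A) / measure P (path N x) =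
      \<P>(\<omega> in P. \<forall>n\<in>{0..N}. W n \<omega> \<in> A n \<bar> \<forall>n\<in>{0..N}. X n \<omega> = x n)"
      unfolding cond_prob_def path_def cyl_def
      by (intro arg_cong2[where f="(/)"] arg_cong[where f="measure P"]) auto
    also have "\<dots> = (\<Prod>n\<in>{0..N}. measure (f (x n)) (A n))"
      using single prodP[OF A, of N x] True by (simp add: path_def)
    finally show ?thesis using True by (simp add: field_simps)
  next
    case False
    then have "measure P (path N x) = 0"
      using measure_nonneg[of P "path N x"] by linarith
    moreover have "measure P (cyl N x A) \<le> measure P (path N x)"
      by (rule finite_measure_mono) (auto simp: path_def cyl_def)
    ultimately show ?thesis
      using measure_nonneg[of P "cyl N x A"] by simp
  qed
  \<comment> \<open>The one-step identity on the generating events, as a quotient-free form of the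
    two product formulas.\<close>
  have cyl_Suc: "emeasure P (cyl (Suc N) x A) =
      emeasure P (cyl N x A) * ennreal (pmf (K (x N)) (x (Suc N))) * emeasure (f (x (Suc N))) (A (Suc N))"
    if "\<And>n. A n \<in> sets borel" for N x A
    unfolding emeasure_eq_measure fm cyl_eq[OF that] path_Suc
    by (simp add: ennreal_mult[symmetric] prod_nonneg atLeast0_atMost_Suc mult_ac)

  define cyls where "cyls N = {cyl N x A | x A. \<forall>n. A n \<in> sets borel}" for N
  define F where "F N = sigma (space P) (cyls N)" for N
  have cylsI: "cyl N x A \<in> cyls N" if "\<And>n. A n \<in> sets borel" for N x A
    using that unfolding cyls_def by blast
  have cyls_Pow: "cyls N \<subseteq> Pow (space P)" for N
    by (auto simp: cyls_def cyl_def)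
  have sets_F: "sets (F N) = sigma_sets (space P) (cyls N)" and space_F: "space (F N) = space P" for N
    using cyls_Pow by (simp_all add: F_def)
  have sets_F_P: "sets (F N) \<subseteq> sets P" for N
    unfolding sets_F by (rule sets.sigma_sets_subset) (auto simp: cyls_def intro: cyl_sets)
  have countable_paths: "countable {x \<in> {0..N} \<rightarrow>\<^sub>E (UNIV :: 'x set). S x}" for N :: nat and S
    by (rule countable_subset[of _ "{0..N} \<rightarrow>\<^sub>E UNIV"]) (auto intro!: countable_PiE)
  \<comment> \<open>There are only countably many state paths up to \<open>N\<close>, so any
    condition \<open>S\<close> on the path is a countable union of cylinders. The locale's
    measurability conditions are read off from this.\<close>
  have F_union: "{\<omega> \<in> space P. S (\<lambda>n\<in>{0..N}. X n \<omega>) \<and> (\<forall>n\<in>{0..N}. W n \<omega> \<in> A n)} \<in> sets (F N)"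
    if "\<And>n. A n \<in> sets borel" for N S A
  proof -
    have "(\<Union>x\<in>{x \<in> {0..N} \<rightarrow>\<^sub>E UNIV. S x}. cyl N x A) \<in> sets (F N)"
      using that countable_paths unfolding sets_F
      by (intro sigma_sets_UNION) (auto simp: cyls_def intro!: sigma_sets.Basic)
    also have "(\<Union>x\<in>{x \<in> {0..N} \<rightarrow>\<^sub>E UNIV. S x}. cyl N x A) =
      {\<omega> \<in> space P. S (\<lambda>n\<in>{0..N}. X n \<omega>) \<and> (\<forall>n\<in>{0..N}. W n \<omega> \<in> A n)}"
    proof (intro equalityI subsetI)
      fix \<omega> assume "\<omega> \<in> (\<Union>x\<in>{x \<in> {0..N} \<rightarrow>\<^sub>E UNIV. S x}. cyl N x A)"
      then obtain x where x: "x \<in> {0..N} \<rightarrow>\<^sub>E UNIV" "S x" "\<omega> \<in> cyl N x A" by auto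
      then have "(\<lambda>n\<in>{0..N}. X n \<omega>) = x"
        by (auto simp: fun_eq_iff cyl_def PiE_def extensional_def)
      with x show "\<omega> \<in> {\<omega> \<in> space P. S (\<lambda>n\<in>{0..N}. X n \<omega>) \<and> (\<forall>n\<in>{0..N}. W n \<omega> \<in> A n)}"
        by (auto simp: cyl_def)
    next
      fix \<omega> assume "\<omega> \<in> {\<omega> \<in> space P. S (\<lambda>n\<in>{0..N}. X n \<omega>) \<and> (\<forall>n\<in>{0..N}. W n \<omega> \<in> A n)}"
      then show "\<omega> \<in> (\<Union>x\<in>{x \<in> {0..N} \<rightarrow>\<^sub>E UNIV. S x}. cyl N x A)"
        by (intro UN_I[of "\<lambda>n\<in>{0..N}. X n \<omega>"]) (auto simp: cyl_def)
    qed
    finally show ?thesis .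
  qed

  have "hidden_chain P F X W (\<lambda>a b. ennreal (pmf (K a) b)) f"
  proof (intro hidden_chain.intro hidden_chain_axioms.intro)
    show "prob_space P" by (rule prob_space_axioms)
    fix N
    show "space (F N) = space P" "sets (F N) \<subseteq> sets P" by fact+
    show "sets (F N) \<subseteq> sets (F (Suc N))"
      unfolding sets_F[of N] space_F[of "Suc N", symmetric]
    proof (rule sets.sigma_sets_subset, unfold cyls_def, safe)
      fix x and A :: "nat \<Rightarrow> 'r set" assume "\<forall>n. A n \<in> sets borel"
      then show "cyl N x A \<in> sets (F (Suc N))"
        using F_union[of "\<lambda>n. if n \<le> N then A n else UNIV" "\<lambda>y. \<forall>n\<in>{0..N}. y n = x n" "Suc N"]
        by (auto simp: cyl_def atLeast0_atMost_Suc conj_commute ball_conj_distrib cong: conj_cong)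
    qed
    show "X N \<in> measurable (F N) (count_space UNIV)"
      unfolding measurable_count_space_eq2_countable
    proof safe
      fix a show "X N -` {a} \<inter> space (F N) \<in> sets (F N)"
        using F_union[of "\<lambda>_. UNIV" "\<lambda>y. y N = a" N] by (simp add: vimage_def space_F Int_def conj_commute)
    qed auto
    show "W N \<in> borel_measurable (F N)"
    proof (rule measurableI)
      fix B :: "'r set" assume "B \<in> sets borel"
      then have "{\<omega> \<in> space P. True \<and> (\<forall>n\<in>{0..N}. W n \<omega> \<in> (if n = N then B else UNIV))} \<in> sets (F N)"
        by (intro F_union) auto
      also have "{\<omega> \<in> space P. True \<and> (\<forall>n\<in>{0..N}. W n \<omega> \<in> (if n = N then B else UNIV))} =
          W N -` B \<inter> space (F N)"
        by (auto simp: space_F split: if_splits)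
      finally show "W N -` B \<inter> space (F N) \<in> sets (F N)" .
    qed simp
    fix Q a b and B :: "'r set"
    assume Q: "Measurable.pred (F N) Q" and B [measurable]: "B \<in> sets borel"
    define S where "S = {\<omega> \<in> space P. X N \<omega> = a}"
    define S' where "S' = {\<omega> \<in> space P. X N \<omega> = a \<and> X (Suc N) \<omega> = b \<and> W (Suc N) \<omega> \<in> B}"
    define c where "c = ennreal (pmf (K a) b) * emeasure (f b) B"
    have [measurable]: "S \<in> sets P" "S' \<in> sets P"
      unfolding S_def S'_def by measurable
    \<comment> \<open>As functions of the past event, the two sides of the one-step identity are the
      measures \<open>M1\<close> and \<open>M2\<close> on \<open>F N\<close>; it remains to compare
      them on cylinders.\<close>
    define M1 where "M1 = restr_to_subalg (density P (indicator S')) (F N)"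
    define M2 where "M2 = scale_measure c (restr_to_subalg (density P (indicator S)) (F N))"
    have sub: "subalgebra (density P g) (F N)" for g
      by (simp add: subalgebra_def space_F sets_F_P)
    have M1: "emeasure M1 A = emeasure P (S' \<inter> A)" and M2: "emeasure M2 A = c * emeasure P (S \<inter> A)"
      if "A \<in> sets (F N)" for A
      using that sets_F_P[of N]
      by (auto simp: M1_def M2_def emeasure_restr_to_subalg[OF sub] emeasure_restricted subset_iff)
    have "M1 = M2"
    proof (rule measure_eqI_generator_eq_countable)
      show "cyls N \<subseteq> Pow (space P)" by fact
      show "Int_stable (cyls N)"
      proof (rule Int_stableI)
        fix C C' assume "C \<in> cyls N" "C' \<in> cyls N"
        then obtain x A x' A' where C: "C = cyl N x A" "C' = cyl N x' A'"
          and A: "\<And>n. A n \<in> sets borel" "\<And>n. A' n \<in> sets borel"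
          by (auto simp: cyls_def)
        \<comment> \<open>Where the two paths disagree the intersection is empty; this is encoded by
          an empty set of observations so that it is again a cylinder.\<close>
        have "C \<inter> C' = cyl N x (\<lambda>n. if x n = x' n then A n \<inter> A' n else {})"
          by (auto simp: C cyl_def split: if_splits) 
        then show "C \<inter> C' \<in> cyls N"
          using A by (auto simp: cyls_def intro!: exI[of _ x] exI[of _ "\<lambda>n. if x n = x' n then A n \<inter> A' n else {}"])
      qed
      show "sets M1 = sigma_sets (space P) (cyls N)" "sets M2 = sigma_sets (space P) (cyls N)"
        unfolding M1_def M2_def by (simp_all add: sets_restr_to_subalg[OF sub] sets_F)
      \<comment> \<open>The cylinders that fix only the path form a countable cover of the space by
        sets of finite measure, as the uniqueness theorem requires.\<close>
      let ?A = "(\<lambda>x. cyl N x (\<lambda>_. UNIV)) ` {x \<in> {0..N} \<rightarrow>\<^sub>E UNIV. True}"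
      show sub_cyls: "?A \<subseteq> cyls N"
        by (intro image_subsetI cylsI space_in_borel)
      show "countable ?A" using countable_paths by (rule countable_image)
      show "\<Union> ?A = space P"
      proof (intro equalityI subsetI)
        fix \<omega> assume "\<omega> \<in> space P"
        then show "\<omega> \<in> \<Union> ?A"
          by (intro UN_I[of "\<lambda>n\<in>{0..N}. X n \<omega>"]) (auto simp: cyl_def)
      qed (auto simp: cyl_def)
      show "emeasure M1 C \<noteq> \<infinity>" if "C \<in> ?A" for C
      proof -
        have "C \<in> sets (F N)" using that sub_cyls unfolding sets_F by (blast intro: sigma_sets.Basic)
        then show ?thesis by (simp add: M1 emeasure_eq_measure)
      qed
      fix C assume C: "C \<in> cyls N"
      then have CF: "C \<in> sets (F N)" by (auto simp: sets_F)
      from C obtain x A where xA: "C = cyl N x A" and A: "\<And>n. A n \<in> sets borel"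
        by (auto simp: cyls_def)
      show "emeasure M1 C = emeasure M2 C"
      proof (cases "x N = a")
        case True
        \<comment> \<open>The cylinder is extended to time \<open>Suc N\<close> by the next state
          \<open>b\<close> and the set \<open>B\<close>; up to time \<open>N\<close> nothing
          changes, so \<open>cyl_Suc\<close> compares the two measures.\<close>
        define x' where "x' = x(Suc N := b)"
        define A' where "A' = A(Suc N := B)"
        have A': "A' n \<in> sets borel" for n using A B by (simp add: A'_def)
        have "S' \<inter> C = cyl (Suc N) x' A'"
          using True by (auto simp: xA S'_def cyl_def x'_def A'_def atLeast0_atMost_Suc)
        moreover have "S \<inter> C = cyl N x' A'"
          using True by (auto simp: xA S_def cyl_def x'_def A'_def)
        ultimately show ?thesis
          using cyl_Suc[of A' N x', OF A'] True
          by (simp add: M1[OF CF] M2[OF CF] c_def x'_def A'_def mult_ac)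
      next
        case False
        then have "S' \<inter> C = {}" "S \<inter> C = {}"
          by (auto simp: xA S_def S'_def cyl_def)
        then show ?thesis by (simp add: M1[OF CF] M2[OF CF])
      qed
    qed
    moreover have QF: "{\<omega> \<in> space P. Q \<omega>} \<in> sets (F N)"
      using Q by (simp add: pred_def space_F)
    ultimately have "emeasure P (S' \<inter> {\<omega> \<in> space P. Q \<omega>}) = c * emeasure P (S \<inter> {\<omega> \<in> space P. Q \<omega>})"
      using M1[OF QF] M2[OF QF] by simp
    moreover have "S' \<inter> {\<omega> \<in> space P. Q \<omega>} =
        {\<omega> \<in> space P. Q \<omega> \<and> X N \<omega> = a \<and> X (Suc N) \<omega> = b \<and> W (Suc N) \<omega> \<in> B}"
      "S \<inter> {\<omega> \<in> space P. Q \<omega>} = {\<omega> \<in> space P. Q \<omega> \<and> X N \<omega> = a}"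
      by (auto simp: S_def S'_def)
    ultimately show "emeasure P {\<omega> \<in> space P. Q \<omega> \<and> X N \<omega> = a \<and> X (Suc N) \<omega> = b \<and> W (Suc N) \<omega> \<in> B} =
      emeasure P {\<omega> \<in> space P. Q \<omega> \<and> X N \<omega> = a} * ennreal (pmf (K a) b) * emeasure (f b) B"
      by (simp add: c_def mult_ac)
  qed (rule f)+
  moreover have "emeasure P {\<omega> \<in> space P. X 0 \<omega> = x \<and> W 0 \<omega> \<in> B} =
      emeasure P {\<omega> \<in> space P. X 0 \<omega> = x} * emeasure (f x) B" if "B \<in> sets borel" for x B
    using cyl_eq[of "\<lambda>_. B" 0 "\<lambda>_. x"] that
    by (simp add: cyl_def path_def emeasure_eq_measure fm ennreal_mult[symmetric])
  ultimately show thesis by (rule that)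
qed

text \<open>Recurrence is defined by conditioning on each initial state of positive probability.
  Initial states of probability zero contribute null sets, and there are only countably many states,
  so one almost sure statement results.\<close>

lemma (in prob_space) AE_recurrent_chain:
  fixes X :: "nat \<Rightarrow> 'a \<Rightarrow> 'x::countable"
  assumes X [measurable]: "\<And>n. X n \<in> measurable M (count_space UNIV)"
    and \<X>: "\<And>\<omega>. \<omega> \<in> space M \<Longrightarrow> X 0 \<omega> \<in> \<X>" and rec: "recurrent_chain M 0 \<X> X"
  shows "AE \<omega> in M. infinite {t. X t \<omega> = X 0 \<omega>}"
proof -
  have "AE \<omega> in M. \<forall>x. X 0 \<omega> = x \<longrightarrow> infinite {t. X t \<omega> = x}"
    unfolding AE_all_countable
  proof
    fix x
    have [measurable]: "Measurable.pred M (\<lambda>\<omega>. infinite {t. X t \<omega> = x})"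
      unfolding infinite_nat_iff_unbounded_le mem_Collect_eq by measurable
    have "\<P>(\<omega> in M. infinite {t. X t \<omega> = x} \<and> X 0 \<omega> = x) = \<P>(\<omega> in M. X 0 \<omega> = x)"
    proof (cases "\<P>(\<omega> in M. X 0 \<omega> = x) > 0")
      case True
      then have "x \<in> \<X>"
        using \<X> by (metis (mono_tags, lifting) Collect_empty_eq less_irrefl measure_empty)
      with True rec show ?thesis
        by (simp add: recurrent_chain_def cond_prob_def)
    next
      case False
      moreover have "\<P>(\<omega> in M. infinite {t. X t \<omega> = x} \<and> X 0 \<omega> = x) \<le> \<P>(\<omega> in M. X 0 \<omega> = x)"
        by (intro finite_measure_mono) auto
      ultimately show ?thesis
        using measure_nonneg[of M "{\<omega> \<in> space M. infinite {t. X t \<omega> = x} \<and> X 0 \<omega> = x}"]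
        by linarith
    qed
    then have "measure M ({\<omega> \<in> space M. X 0 \<omega> = x} - {\<omega> \<in> space M. infinite {t. X t \<omega> = x} \<and> X 0 \<omega> = x}) = 0"
      by (subst finite_measure_Diff) auto
    also have "{\<omega> \<in> space M. X 0 \<omega> = x} - {\<omega> \<in> space M. infinite {t. X t \<omega> = x} \<and> X 0 \<omega> = x} =
      {\<omega> \<in> space M. \<not> (X 0 \<omega> = x \<longrightarrow> infinite {t. X t \<omega> = x})}"
      by auto
    finally show "AE \<omega> in M. X 0 \<omega> = x \<longrightarrow> infinite {t. X t \<omega> = x}"
      by (subst AE_iff_measurable[OF _ refl]) (auto simp: emeasure_eq_measure)
  qed
  then show ?thesis by simp
qed

section \<open>Successors\<close>

lemma measurable_successors:
  fixes Y :: "nat \<Rightarrow> 'w \<Rightarrow> 's::polish_space"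
  assumes Y [measurable]: "\<And>t. Y t \<in> borel_measurable M" and E: "E j \<in> sets borel" and "n \<ge> 1"
  shows "successors E Y j n \<in> borel_measurable M"
proof -
  obtain m where n: "n = Suc m" using \<open>n \<ge> 1\<close> by (cases n) auto
  have [measurable]: "Some -` E j \<in> sets borel" using E by (simp add: sets_borel_option_iff[symmetric])
  have "Measurable.pred M (\<lambda>\<omega>. Y t \<omega> \<in> Some -` E j)" for t by measurable
  then show ?thesis
    unfolding successors_eq_after_visit[abs_def] n
    by (intro measurable_after_visit[where N=borel])
      (auto simp: visit_times_def sets_borel_option_iff[symmetric])
qed

text \<open>A visit may occur arbitrarily late, so a successor depends on the whole path and
  finitely many coordinates do not suffice. Equal finite-dimensional distributions agree on the
  cylinders, which determine the law on the infinite product.\<close>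

lemma distr_path_eq:
  fixes Y :: "nat \<Rightarrow> 'w \<Rightarrow> 'r::polish_space" and W :: "nat \<Rightarrow> 'v \<Rightarrow> 'r"
  assumes "prob_space M" and Y [measurable]: "\<And>t. Y t \<in> borel_measurable M"
    and W [measurable]: "\<And>t. W t \<in> borel_measurable P"
    and fdd: "same_fdd 0 M Y P W"
  shows "distr M (\<Pi>\<^sub>M t\<in>UNIV. borel) (\<lambda>\<omega> t. Y t \<omega>) = distr P (\<Pi>\<^sub>M t\<in>UNIV. borel) (\<lambda>\<omega> t. W t \<omega>)"
proof (rule measure_eqI_PiM_infinite)
  have mY [measurable]: "(\<lambda>\<omega> t. Y t \<omega>) \<in> measurable M (\<Pi>\<^sub>M t\<in>UNIV. borel)"
    by (rule measurable_PiM_single') auto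
  have mW [measurable]: "(\<lambda>\<omega> t. W t \<omega>) \<in> measurable P (\<Pi>\<^sub>M t\<in>UNIV. borel)"
    by (rule measurable_PiM_single') auto
  show "finite_measure (distr M (\<Pi>\<^sub>M t\<in>UNIV. borel) (\<lambda>\<omega> t. Y t \<omega>))"
    using prob_space.prob_space_distr[OF \<open>prob_space M\<close> mY] by (rule prob_space.finite_measure)
  fix A :: "nat \<Rightarrow> 'r set" and J :: "nat set"
  assume J: "finite J" and A: "\<And>i. i \<in> J \<Longrightarrow> A i \<in> sets borel"
  let ?R = "prod_emb UNIV (\<lambda>_. borel) J (Pi\<^sub>E J A)"
  have R: "?R \<in> sets (\<Pi>\<^sub>M t\<in>UNIV. borel)"
    using J A by (intro sets_PiM_I) auto
  have PJ: "Pi\<^sub>E J A \<in> sets (\<Pi>\<^sub>M t\<in>J. borel)"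
    using J A by (intro sets_PiM_I_finite) auto
  have "emeasure (distr M (\<Pi>\<^sub>M t\<in>UNIV. borel) (\<lambda>\<omega> t. Y t \<omega>)) ?R =
      emeasure (distr M (\<Pi>\<^sub>M t\<in>J. borel) (\<lambda>\<omega>. \<lambda>t\<in>J. Y t \<omega>)) (Pi\<^sub>E J A)"
    unfolding emeasure_distr[OF mY R]
    by (subst emeasure_distr[OF _ PJ]) (auto simp: prod_emb_def intro!: arg_cong2[where f=emeasure])
  also have "\<dots> = emeasure (distr P (\<Pi>\<^sub>M t\<in>J. borel) (\<lambda>\<omega>. \<lambda>t\<in>J. W t \<omega>)) (Pi\<^sub>E J A)"
    using fdd J by (simp add: same_fdd_def)
  also have "\<dots> = emeasure (distr P (\<Pi>\<^sub>M t\<in>UNIV. borel) (\<lambda>\<omega> t. W t \<omega>)) ?R"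
    unfolding emeasure_distr[OF mW R]
    by (subst emeasure_distr[OF _ PJ]) (auto simp: prod_emb_def intro!: arg_cong2[where f=emeasure])
  finally show "emeasure (distr M (\<Pi>\<^sub>M t\<in>UNIV. borel) (\<lambda>\<omega> t. Y t \<omega>)) ?R =
    emeasure (distr P (\<Pi>\<^sub>M t\<in>UNIV. borel) (\<lambda>\<omega> t. W t \<omega>)) ?R" .
qed auto

text \<open>The successors are one fixed measurable functional of the path, here
  \<open>successors\<close> applied to the coordinate process, so their law is an image of the path
  law.\<close>

lemma distr_successors:
  fixes Y :: "nat \<Rightarrow> 'w \<Rightarrow> 's::polish_space"
  assumes Y [measurable]: "\<And>t. Y t \<in> borel_measurable M" and E: "E j \<in> sets borel" and J: "J \<subseteq> {1..}"
  shows "distr M (\<Pi>\<^sub>M n\<in>J. borel) (\<lambda>\<omega>. \<lambda>n\<in>J. successors E Y j n \<omega>) =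
    distr (distr M (\<Pi>\<^sub>M t\<in>UNIV. borel) (\<lambda>\<omega> t. Y t \<omega>)) (\<Pi>\<^sub>M n\<in>J. borel)
      (\<lambda>s. \<lambda>n\<in>J. successors E (\<lambda>t s. s t) j n s)"
proof -
  let ?N = "\<Pi>\<^sub>M t\<in>UNIV. (borel :: 's measure)"
  have "successors E (\<lambda>t s. s t) j n \<in> borel_measurable ?N" if "n \<in> J" for n
    using J that by (intro measurable_successors E) auto
  then have \<sigma>: "(\<lambda>s. \<lambda>n\<in>J. successors E (\<lambda>t s. s t) j n s) \<in> measurable ?N (\<Pi>\<^sub>M n\<in>J. borel)"
    by (intro measurable_restrict)
  have "(\<lambda>\<omega> t. Y t \<omega>) \<in> measurable M ?N"
    by (rule measurable_PiM_single') auto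
  then show ?thesis
    by (subst distr_distr[OF \<sigma>]) (simp_all add: comp_def successors_def visit_times_def)
qed

lemma same_fdd_successors:
  fixes Y :: "nat \<Rightarrow> 'w \<Rightarrow> 's::polish_space" and W :: "nat \<Rightarrow> 'v \<Rightarrow> 's"
  assumes "prob_space M" and Y: "\<And>t. Y t \<in> borel_measurable M"
    and W: "\<And>t. W t \<in> borel_measurable P"
    and fdd: "same_fdd 0 M Y P W" and E: "E j \<in> sets borel"
  shows "same_fdd 1 M (successors E Y j) P (successors E W j)"
  unfolding same_fdd_def using distr_path_eq[OF \<open>prob_space M\<close> Y W fdd]
  by (simp add: distr_successors[of Y M E j, OF Y E] distr_successors[of W P E j, OF W E])

theorem proposition4p1:
  fixes M :: "'w measure"
    and E :: "nat \<Rightarrow> 's::polish_space option set"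
    and Y :: "nat \<Rightarrow> 'w \<Rightarrow> 's"
  assumes "prob_space M"
    and "\<And>j. E j \<in> sets borel"
    and "disjoint_family E"
    and "(\<Union>j. E j) = UNIV"
    and "E 0 = {None}"
    and "recurrent_hmm M 0 Y"
  shows "\<forall>j\<ge>1. recurrent_hmm M 1 (successors E Y j)"
proof (intro allI impI)
  fix j :: nat
  obtain P :: "(nat \<Rightarrow> nat \<times> 's) measure" and \<X> :: "nat set" and X W
    where pair: "hmm_pair P 0 \<X> X W" and rec: "recurrent_chain P 0 \<X> X" and fdd: "same_fdd 0 M Y P W"
    and Y: "\<And>t. Y t \<in> borel_measurable M"
    using assms(6) by (auto simp: recurrent_hmm_def)
  obtain F K f where hc: "hidden_chain P F X W K f"
    and init: "\<And>x B. B \<in> sets borel \<Longrightarrow> emeasure P {\<omega> \<in> space P. X 0 \<omega> = x \<and> W 0 \<omega> \<in> B} =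
      emeasure P {\<omega> \<in> space P. X 0 \<omega> = x} * emeasure (f x) B"
    using hidden_chain_of_hmm_pair[OF pair] by blast
  interpret hidden_chain P F X W K f by (rule hc)
  \<comment> \<open>The part of \<open>E j\<close> inside \<open>S\<close>: an observation is never
    the added point, so only this part decides about visits.\<close>
  define E' where "E' = Some -` E j"
  have E': "E' \<in> sets borel"
    using assms(2)[of j] by (simp add: E'_def sets_borel_option_iff[symmetric])
  have "X 0 \<omega> \<in> \<X>" if "\<omega> \<in> space P" for \<omega>
    using pair measurable_space[of "X 0" P "count_space \<X>" \<omega>] that
    by (simp add: hmm_pair_def markov_chain_def)
  then have AE: "AE \<omega> in P. infinite {t. X t \<omega> = X 0 \<omega>}"
    using rec by (intro AE_recurrent_chain) auto
  interpret flag: hidden_chain P F "\<lambda>t \<omega>. (X t \<omega>, W t \<omega> \<in> E')" W "flag_kernel K f E'" "flag_readout f E'"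
    by (rule hidden_chain_flag[OF E'])
  \<comment> \<open>The set \<open>D\<close> consists of the states whose flag is true, so visits to
    \<open>D\<close> are exactly visits of the observations to \<open>E j\<close>.\<close>
  interpret flag: hidden_chain_visits P F "\<lambda>t \<omega>. (X t \<omega>, W t \<omega> \<in> E')" W "flag_kernel K f E'" "flag_readout f E'"
    "{p. snd p}" ..
  have V: "flag.V = successors E W j"
    unfolding fun_eq_iff flag.V_def successors_eq_after_visit visit_times_def by (simp add: E'_def)
  show "recurrent_hmm M 1 (successors E Y j)"
  \<comment> \<open>The states of \<open>flag.U\<close> are optional flagged states rather than
    natural numbers; this rule accepts any countable state space.\<close>
  proof (rule recurrent_hmmI)
    show "successors E Y j n \<in> borel_measurable M" if "n \<ge> 1" for n
      using Y assms(2) that by (rule measurable_successors)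
    show "hmm_pair P 1 UNIV flag.U (successors E W j)"
      using flag.hmm_pair_visits by (simp add: V)
    show "recurrent_chain P 1 UNIV flag.U"
      \<comment> \<open>Recurrence passes from the original chain to the initial flagged state, then
        to all flagged states on the path, and finally to the chain after the visits.\<close>
      by (intro flag.recurrent_visits flag.AE_recurrent_propagate AE_recurrent_flag[OF E' AE] init)
    show "same_fdd 1 M (successors E Y j) P (successors E W j)"
      using assms(1) Y _ fdd assms(2) by (rule same_fdd_successors) simp
  qed
qed

end
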